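(* Let $A = B \times H$ be a biproduct over a field $k$ and let $F \in \mathrm{End}_{\mathrm{Hopf}}(A, \pi)$. Then: (a) $F_L$ is a left $H$-module map if and only if $F_L(h_{(1)}\cdot b)F_R(h_{(2)}) = F_R(h_{(1)})F_L(h_{(2)}\cdot b)$ holds for all $h \in H$ and $b \in B$. (b) If $B$ is commutative and $H$ is cocommutative then $F_L$ is a left $H$-module map.
   Context: Let $k$ be a field and $H$ a Hopf algebra over $k$. Sweedler notation: $\Delta(c) = c_{(1)} \otimes c_{(2)}$; for a left $H$-comodule $(M,\rho)$, $\rho(m) = m_{(-1)} \otimes m_{(0)} \in H \otimes M$. Biproduct. $B$ is a vector space which is an algebra, a coalgebra, a left $H$-module and a left $H$-comodule over $k$, such that: $B$ is a left $H$-module algebra, left $H$-module coalgebra, left $H$-comodule algebra, and left $H$-comodule coalgebra ($b_{(-1)}\epsilon(b_{(0)}) = \epsilon(b)1$, $b_{(1)(-1)}b_{(2)(-1)} \otimes b_{(1)(0)} \otimes b_{(2)(0)} = b_{(-1)} \otimes b_{(0)(1)} \otimes b_{(0)(2)}$); $\epsilon : B \to k$ is an algebra map and $\Delta(1) = 1 \otimes 1$; $\Delta(bb') = b_{(1)}(b_{(2)(-1)}\cdot b'_{(1)}) \otimes b_{(2)(0)}b'_{(2)}$; $h_{(1)}b_{(-1)} \otimes h_{(2)}\cdot b_{(0)} = (h_{(1)}\cdot b)_{(-1)}h_{(2)} \otimes (h_{(1)}\cdot b)_{(0)}$; and $\mathrm{Id}_B$ has a convolution inverse. (Equivalently, $B$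 is a Hopf algebra in ${}_H^H\mathcal{YD}$.) The biproduct $A = B \times H$ is the Hopf algebra over $k$ with underlying space $B \otimes H$ (tensors written $b \times h$), product $(b \times h)(b' \times h') = b(h_{(1)}\cdot b') \times h_{(2)}h'$, unit $1 \times 1$, coproduct $\Delta(b \times h) = (b_{(1)} \times b_{(2)(-1)}h_{(1)}) \otimes (b_{(2)(0)} \times h_{(2)})$ and counit $\epsilon \otimes \epsilon$. Maps: $\pi : A \to H$, $\pi(b \times h) = \epsilon(b)h$; $j : H \to A$, $j(h) = 1 \times h$; $\Pi : A \to B$, $\Pi(b \times h) = b\epsilon(h)$; $J : B \to A$, $J(b) = b \times 1$. $\mathrm{End}_{\mathrm{Hopf}}(A, \pi)$ is the set of Hopf algebra endomorphisms $F$ of $A$ with $\pi \circ F = \pi$. For such $F$, $F_L = \Pi \circ F \circ J : B \to B$ and $F_R = \Pi \circ F \circ j : H \to B$. *)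

theory Defs
  imports "HOL-Algebra.Module"
begin

section \<open>Tensor products of vector spaces\<close>

text \<open>
  A formal finite sum \<open>v\<^sub>1 \<otimes> w\<^sub>1 + \<dots> + v\<^sub>n \<otimes> w\<^sub>n\<close> is represented by the list
  of the pairs \<open>(v\<^sub>i, w\<^sub>i)\<close>, and the tensor product is the quotient by the least congruence that
  makes addition commutative and the symbol \<open>\<otimes>\<close> bilinear.  Because the formal sums form a monoid
  rather than a group, \<open>0 \<otimes> w = 0\<close> has to be listed among the relations; the scalars need no
  separate coefficients since they can be absorbed into the factors.
\<close>

definition formal_sums ::
    "('k, 'a, 'm) module_scheme \<Rightarrow> ('k, 'b, 'n) module_scheme \<Rightarrow> ('a \<times> 'b) list set" where
  "formal_sums V W = {xs. set xs \<subseteq> carrier V \<times> carrier W}"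

inductive tensor_eq ::
    "('k, 'l) ring_scheme \<Rightarrow> ('k, 'a, 'm) module_scheme \<Rightarrow> ('k, 'b, 'n) module_scheme
      \<Rightarrow> ('a \<times> 'b) list \<Rightarrow> ('a \<times> 'b) list \<Rightarrow> bool"
  for K and V and W where
  refl: "xs \<in> formal_sums V W \<Longrightarrow> tensor_eq K V W xs xs"
| sym: "tensor_eq K V W xs ys \<Longrightarrow> tensor_eq K V W ys xs"
| trans: "tensor_eq K V W xs ys \<Longrightarrow> tensor_eq K V W ys zs \<Longrightarrow> tensor_eq K V W xs zs"
| append: "tensor_eq K V W xs xs' \<Longrightarrow> tensor_eq K V W ys ys' \<Longrightarrow>
    tensor_eq K V W (xs @ ys) (xs' @ ys')"
| commute: "xs \<in> formal_sums V W \<Longrightarrow> ys \<in> formal_sums V W \<Longrightarrow>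
    tensor_eq K V W (xs @ ys) (ys @ xs)"
| zero: "w \<in> carrier W \<Longrightarrow> tensor_eq K V W [(\<zero>\<^bsub>V\<^esub>, w)] []"
| add_left: "v \<in> carrier V \<Longrightarrow> v' \<in> carrier V \<Longrightarrow> w \<in> carrier W \<Longrightarrow>
    tensor_eq K V W [(v \<oplus>\<^bsub>V\<^esub> v', w)] [(v, w), (v', w)]"
| add_right: "v \<in> carrier V \<Longrightarrow> w \<in> carrier W \<Longrightarrow> w' \<in> carrier W \<Longrightarrow>
    tensor_eq K V W [(v, w \<oplus>\<^bsub>W\<^esub> w')] [(v, w), (v, w')]"
| smult: "a \<in> carrier K \<Longrightarrow> v \<in> carrier V \<Longrightarrow> w \<in> carrier W \<Longrightarrow>
    tensor_eq K V W [(a \<odot>\<^bsub>V\<^esub> v, w)] [(v, a \<odot>\<^bsub>W\<^esub> w)]"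

definition tensor_class ::
    "('k, 'l) ring_scheme \<Rightarrow> ('k, 'a, 'm) module_scheme \<Rightarrow> ('k, 'b, 'n) module_scheme
      \<Rightarrow> ('a \<times> 'b) list \<Rightarrow> ('a \<times> 'b) list set" where
  "tensor_class K V W xs = {ys. tensor_eq K V W xs ys}"

definition pure_tensor ::
    "('k, 'l) ring_scheme \<Rightarrow> ('k, 'a, 'm) module_scheme \<Rightarrow> ('k, 'b, 'n) module_scheme
      \<Rightarrow> 'a \<Rightarrow> 'b \<Rightarrow> ('a \<times> 'b) list set" where
  "pure_tensor K V W v w = tensor_class K V W [(v, w)]"

definition tensor_rep :: "('a \<times> 'b) list set \<Rightarrow> ('a \<times> 'b) list" where
  "tensor_rep X = (SOME xs. xs \<in> X)"

text \<open>
  The multiplication and unit below are those of the tensor product of two algebras,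
  \<open>(v \<otimes> w)(v' \<otimes> w') = vv' \<otimes> ww'\<close>; they are only meaningful if both factors are algebras.
\<close>

definition tensor ::
    "('k, 'l) ring_scheme \<Rightarrow> ('k, 'a, 'm) module_scheme \<Rightarrow> ('k, 'b, 'n) module_scheme
      \<Rightarrow> ('k, ('a \<times> 'b) list set) module" where
  "tensor K V W =
    \<lparr> carrier = tensor_class K V W ` formal_sums V W,
      mult = (\<lambda>X Y. tensor_class K V W
        (map (\<lambda>((v, w), (v', w')). (v \<otimes>\<^bsub>V\<^esub> v', w \<otimes>\<^bsub>W\<^esub> w'))
          (List.product (tensor_rep X) (tensor_rep Y)))),
      one = pure_tensor K V W \<one>\<^bsub>V\<^esub> \<one>\<^bsub>W\<^esub>,
      zero = tensor_class K V W [],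
      add = (\<lambda>X Y. tensor_class K V W (tensor_rep X @ tensor_rep Y)),
      smult = (\<lambda>a X. tensor_class K V W (map (\<lambda>(v, w). (a \<odot>\<^bsub>V\<^esub> v, w)) (tensor_rep X))) \<rparr>"

text \<open>
  Sweedler notation.  If \<open>X = v\<^sub>1 \<otimes> w\<^sub>1 + \<dots> + v\<^sub>n \<otimes> w\<^sub>n\<close>, then \<open>sweedler U X f\<close> is
  \<open>f v\<^sub>1 w\<^sub>1 + \<dots> + f v\<^sub>n w\<^sub>n\<close>, computed in \<open>U\<close>; in other words, it is the value at \<open>X\<close> of the linear
  map induced by \<open>f\<close>.  It is independent of the chosen representative whenever \<open>f\<close> is bilinear,
  which is the case in all its uses below.  For instance, \<open>f(c\<^sub>(\<^sub>1\<^sub>), c\<^sub>(\<^sub>2\<^sub>))\<close> is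
  \<open>sweedler U (\<Delta> c) (\<lambda>c1 c2. f c1 c2)\<close>.
\<close>

definition sweedler ::
    "('u, 'z) ring_scheme \<Rightarrow> ('a \<times> 'b) list set \<Rightarrow> ('a \<Rightarrow> 'b \<Rightarrow> 'u) \<Rightarrow> 'u" where
  "sweedler U X f = foldr (\<lambda>(v, w) s. f v w \<oplus>\<^bsub>U\<^esub> s) (tensor_rep X) \<zero>\<^bsub>U\<^esub>"


section \<open>Algebras, coalgebras and Hopf algebras\<close>

definition scalars :: "('k, 'l) ring_scheme \<Rightarrow> ('k, 'k) module" where
  "scalars K = \<lparr> carrier = carrier K, mult = mult K, one = one K, zero = zero K, add = add K,
    smult = mult K \<rparr>"

definition linear_map ::
    "('k, 'l) ring_scheme \<Rightarrow> ('k, 'a, 'm) module_scheme \<Rightarrow> ('k, 'b, 'n) module_scheme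
      \<Rightarrow> ('a \<Rightarrow> 'b) \<Rightarrow> bool" where
  "linear_map K V W f \<longleftrightarrow> f \<in> carrier V \<rightarrow> carrier W \<and>
    (\<forall>x \<in> carrier V. \<forall>y \<in> carrier V. f (x \<oplus>\<^bsub>V\<^esub> y) = f x \<oplus>\<^bsub>W\<^esub> f y) \<and>
    (\<forall>a \<in> carrier K. \<forall>x \<in> carrier V. f (a \<odot>\<^bsub>V\<^esub> x) = a \<odot>\<^bsub>W\<^esub> f x)"

definition algebra_map ::
    "('k, 'l) ring_scheme \<Rightarrow> ('k, 'a, 'm) module_scheme \<Rightarrow> ('k, 'b, 'n) module_scheme
      \<Rightarrow> ('a \<Rightarrow> 'b) \<Rightarrow> bool" where
  "algebra_map K A A' f \<longleftrightarrow> linear_map K A A' f \<and> f \<in> ring_hom A A'"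

text \<open>The locale \<open>algebra\<close> of the library is restricted to commutative algebras.\<close>

locale k_algebra =
  fixes K :: "('k, 'l) ring_scheme" and A :: "('k, 'a, 'm) module_scheme"
  assumes field: "field K"
    and module: "module K A"
    and ring: "ring A"
    and smult_mult: "\<lbrakk> a \<in> carrier K; x \<in> carrier A; y \<in> carrier A \<rbrakk> \<Longrightarrow>
      (a \<odot>\<^bsub>A\<^esub> x) \<otimes>\<^bsub>A\<^esub> y = a \<odot>\<^bsub>A\<^esub> (x \<otimes>\<^bsub>A\<^esub> y)"
    and mult_smult: "\<lbrakk> a \<in> carrier K; x \<in> carrier A; y \<in> carrier A \<rbrakk> \<Longrightarrow>
      x \<otimes>\<^bsub>A\<^esub> (a \<odot>\<^bsub>A\<^esub> y) = a \<odot>\<^bsub>A\<^esub> (x \<otimes>\<^bsub>A\<^esub> y)"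

record ('k, 'a) hopf = "('k, 'a) module" +
  comult :: "'a \<Rightarrow> ('a \<times> 'a) list set"
  counit :: "'a \<Rightarrow> 'k"

locale k_coalgebra =
  fixes K :: "('k, 'l) ring_scheme" and C :: "('k, 'a, 'm) hopf_scheme"
  assumes field: "field K"
    and module: "module K C"
    and comult_linear: "linear_map K C (tensor K C C) (comult C)"
    and counit_linear: "linear_map K C (scalars K) (counit C)"
    and coassoc: "c \<in> carrier C \<Longrightarrow>
      sweedler (tensor K C (tensor K C C)) (comult C c) (\<lambda>x y.
        sweedler (tensor K C (tensor K C C)) (comult C x) (\<lambda>x1 x2.
          pure_tensor K C (tensor K C C) x1 (pure_tensor K C C x2 y))) =
      sweedler (tensor K C (tensor K C C)) (comult C c) (\<lambda>x y.
        pure_tensor K C (tensor K C C) x (comult C y))"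
    and counit_left: "c \<in> carrier C \<Longrightarrow>
      sweedler C (comult C c) (\<lambda>x y. counit C x \<odot>\<^bsub>C\<^esub> y) = c"
    and counit_right: "c \<in> carrier C \<Longrightarrow>
      sweedler C (comult C c) (\<lambda>x y. counit C y \<odot>\<^bsub>C\<^esub> x) = c"

definition coalgebra_map ::
    "('k, 'l) ring_scheme \<Rightarrow> ('k, 'a, 'm) hopf_scheme \<Rightarrow> ('k, 'b, 'n) hopf_scheme
      \<Rightarrow> ('a \<Rightarrow> 'b) \<Rightarrow> bool" where
  "coalgebra_map K C D f \<longleftrightarrow> linear_map K C D f \<and>
    (\<forall>c \<in> carrier C. comult D (f c) =
      sweedler (tensor K D D) (comult C c) (\<lambda>x y. pure_tensor K D D (f x) (f y))) \<and>
    (\<forall>c \<in> carrier C. counit D (f c) = counit C c)"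

definition convolution_inverses ::
    "('k, 'l) ring_scheme \<Rightarrow> ('k, 'a, 'm) hopf_scheme \<Rightarrow> ('k, 'b, 'n) module_scheme
      \<Rightarrow> ('a \<Rightarrow> 'b) \<Rightarrow> ('a \<Rightarrow> 'b) \<Rightarrow> bool" where
  "convolution_inverses K C A f g \<longleftrightarrow> linear_map K C A f \<and> linear_map K C A g \<and>
    (\<forall>c \<in> carrier C.
      sweedler A (comult C c) (\<lambda>x y. f x \<otimes>\<^bsub>A\<^esub> g y) = counit C c \<odot>\<^bsub>A\<^esub> \<one>\<^bsub>A\<^esub> \<and>
      sweedler A (comult C c) (\<lambda>x y. g x \<otimes>\<^bsub>A\<^esub> f y) = counit C c \<odot>\<^bsub>A\<^esub> \<one>\<^bsub>A\<^esub>)"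

locale k_hopf_algebra = k_algebra K H + k_coalgebra K H
  for K :: "('k, 'l) ring_scheme" and H :: "('k, 'h, 'm) hopf_scheme" +
  assumes comult_algebra_map: "algebra_map K H (tensor K H H) (comult H)"
    and counit_algebra_map: "algebra_map K H (scalars K) (counit H)"
    and antipode: "\<exists>S. convolution_inverses K H H (\<lambda>h. h) S"

definition cocommutative ::
    "('k, 'l) ring_scheme \<Rightarrow> ('k, 'a, 'm) hopf_scheme \<Rightarrow> bool" where
  "cocommutative K C \<longleftrightarrow> (\<forall>c \<in> carrier C.
    sweedler (tensor K C C) (comult C c) (\<lambda>x y. pure_tensor K C C y x) = comult C c)"

text \<open>A bialgebra map between Hopf algebras automatically commutes with the antipodes.\<close>

definition hopf_map ::
    "('k, 'l) ring_scheme \<Rightarrow> ('k, 'a, 'm) hopf_scheme \<Rightarrow> ('k, 'b, 'n) hopf_scheme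
      \<Rightarrow> ('a \<Rightarrow> 'b) \<Rightarrow> bool" where
  "hopf_map K A A' F \<longleftrightarrow> algebra_map K A A' F \<and> coalgebra_map K A A' F"


section \<open>Modules and comodules over a Hopf algebra\<close>

locale left_module =
  fixes K :: "('k, 'l) ring_scheme" and H :: "('k, 'h, 'm) hopf_scheme"
    and M :: "('k, 'b, 'n) module_scheme" and act :: "'h \<Rightarrow> 'b \<Rightarrow> 'b"
  assumes act_linear: "h \<in> carrier H \<Longrightarrow> linear_map K M M (act h)"
    and act_linear_left: "m \<in> carrier M \<Longrightarrow> linear_map K H M (\<lambda>h. act h m)"
    and act_mult: "\<lbrakk> h \<in> carrier H; h' \<in> carrier H; m \<in> carrier M \<rbrakk> \<Longrightarrow>
      act (h \<otimes>\<^bsub>H\<^esub> h') m = act h (act h' m)"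
    and act_one: "m \<in> carrier M \<Longrightarrow> act \<one>\<^bsub>H\<^esub> m = m"

locale left_comodule =
  fixes K :: "('k, 'l) ring_scheme" and H :: "('k, 'h, 'm) hopf_scheme"
    and M :: "('k, 'b, 'n) module_scheme" and coact :: "'b \<Rightarrow> ('h \<times> 'b) list set"
  assumes coact_linear: "linear_map K M (tensor K H M) coact"
    and coact_coassoc: "m \<in> carrier M \<Longrightarrow>
      sweedler (tensor K H (tensor K H M)) (coact m) (\<lambda>x n.
        sweedler (tensor K H (tensor K H M)) (comult H x) (\<lambda>x1 x2.
          pure_tensor K H (tensor K H M) x1 (pure_tensor K H M x2 n))) =
      sweedler (tensor K H (tensor K H M)) (coact m) (\<lambda>x n.
        pure_tensor K H (tensor K H M) x (coact n))"
    and coact_counit: "m \<in> carrier M \<Longrightarrow>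
      sweedler M (coact m) (\<lambda>x n. counit H x \<odot>\<^bsub>M\<^esub> n) = m"

definition left_module_map ::
    "('k, 'l) ring_scheme \<Rightarrow> ('k, 'h, 'm) hopf_scheme
      \<Rightarrow> ('k, 'b, 'n) module_scheme \<Rightarrow> ('h \<Rightarrow> 'b \<Rightarrow> 'b)
      \<Rightarrow> ('k, 'c, 'o) module_scheme \<Rightarrow> ('h \<Rightarrow> 'c \<Rightarrow> 'c) \<Rightarrow> ('b \<Rightarrow> 'c) \<Rightarrow> bool" where
  "left_module_map K H M act N act' f \<longleftrightarrow> linear_map K M N f \<and>
    (\<forall>h \<in> carrier H. \<forall>m \<in> carrier M. f (act h m) = act' h (f m))"


section \<open>Biproducts\<close>

text \<open>
  The coaction is written \<open>b \<mapsto> b\<^sub>(\<^sub>-\<^sub>1\<^sub>) \<otimes> b\<^sub>(\<^sub>0\<^sub>)\<close>; its components are bound below as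
  \<open>x\<close> and \<open>b0\<close>, those of the coproduct of \<open>b\<close> as \<open>b1\<close> and \<open>b2\<close>.
\<close>

locale biproduct_datum =
  H: k_hopf_algebra K H + alg: k_algebra K B + coalg: k_coalgebra K B +
  left_module K H B act + left_comodule K H B coact
  for K :: "('k, 'l) ring_scheme" and H :: "('k, 'h, 'm) hopf_scheme"
    and B :: "('k, 'b, 'n) hopf_scheme"
    and act :: "'h \<Rightarrow> 'b \<Rightarrow> 'b" and coact :: "'b \<Rightarrow> ('h \<times> 'b) list set" +
  assumes module_algebra_mult:
      "\<lbrakk> h \<in> carrier H; b \<in> carrier B; b' \<in> carrier B \<rbrakk> \<Longrightarrow>
        act h (b \<otimes>\<^bsub>B\<^esub> b') =
        sweedler B (comult H h) (\<lambda>h1 h2. act h1 b \<otimes>\<^bsub>B\<^esub> act h2 b')"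
    and module_algebra_one:
      "h \<in> carrier H \<Longrightarrow> act h \<one>\<^bsub>B\<^esub> = counit H h \<odot>\<^bsub>B\<^esub> \<one>\<^bsub>B\<^esub>"
    and module_coalgebra_comult:
      "\<lbrakk> h \<in> carrier H; b \<in> carrier B \<rbrakk> \<Longrightarrow>
        comult B (act h b) =
        sweedler (tensor K B B) (comult H h) (\<lambda>h1 h2.
          sweedler (tensor K B B) (comult B b) (\<lambda>b1 b2.
            pure_tensor K B B (act h1 b1) (act h2 b2)))"
    and module_coalgebra_counit:
      "\<lbrakk> h \<in> carrier H; b \<in> carrier B \<rbrakk> \<Longrightarrow>
        counit B (act h b) = counit H h \<otimes>\<^bsub>K\<^esub> counit B b"
    and comodule_algebra_mult:
      "\<lbrakk> b \<in> carrier B; b' \<in> carrier B \<rbrakk> \<Longrightarrow>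
        coact (b \<otimes>\<^bsub>B\<^esub> b') =
        sweedler (tensor K H B) (coact b) (\<lambda>x b0.
          sweedler (tensor K H B) (coact b') (\<lambda>x' b0'.
            pure_tensor K H B (x \<otimes>\<^bsub>H\<^esub> x') (b0 \<otimes>\<^bsub>B\<^esub> b0')))"
    and comodule_algebra_one:
      "coact \<one>\<^bsub>B\<^esub> = pure_tensor K H B \<one>\<^bsub>H\<^esub> \<one>\<^bsub>B\<^esub>"
    and comodule_coalgebra_counit:
      "b \<in> carrier B \<Longrightarrow>
        sweedler H (coact b) (\<lambda>x b0. counit B b0 \<odot>\<^bsub>H\<^esub> x) = counit B b \<odot>\<^bsub>H\<^esub> \<one>\<^bsub>H\<^esub>"
    and comodule_coalgebra_comult:
      "b \<in> carrier B \<Longrightarrow>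
        sweedler (tensor K H (tensor K B B)) (comult B b) (\<lambda>b1 b2.
          sweedler (tensor K H (tensor K B B)) (coact b1) (\<lambda>x b10.
            sweedler (tensor K H (tensor K B B)) (coact b2) (\<lambda>y b20.
              pure_tensor K H (tensor K B B) (x \<otimes>\<^bsub>H\<^esub> y) (pure_tensor K B B b10 b20)))) =
        sweedler (tensor K H (tensor K B B)) (coact b) (\<lambda>x b0.
          pure_tensor K H (tensor K B B) x (comult B b0))"
    and counit_B_algebra_map: "algebra_map K B (scalars K) (counit B)"
    and comult_B_one: "comult B \<one>\<^bsub>B\<^esub> = pure_tensor K B B \<one>\<^bsub>B\<^esub> \<one>\<^bsub>B\<^esub>"
    and comult_B_mult:
      "\<lbrakk> b \<in> carrier B; b' \<in> carrier B \<rbrakk> \<Longrightarrow>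
        comult B (b \<otimes>\<^bsub>B\<^esub> b') =
        sweedler (tensor K B B) (comult B b) (\<lambda>b1 b2.
          sweedler (tensor K B B) (comult B b') (\<lambda>b1' b2'.
            sweedler (tensor K B B) (coact b2) (\<lambda>x b20.
              pure_tensor K B B (b1 \<otimes>\<^bsub>B\<^esub> act x b1') (b20 \<otimes>\<^bsub>B\<^esub> b2'))))"
    and yetter_drinfeld:
      "\<lbrakk> h \<in> carrier H; b \<in> carrier B \<rbrakk> \<Longrightarrow>
        sweedler (tensor K H B) (comult H h) (\<lambda>h1 h2.
          sweedler (tensor K H B) (coact b) (\<lambda>x b0.
            pure_tensor K H B (h1 \<otimes>\<^bsub>H\<^esub> x) (act h2 b0))) =
        sweedler (tensor K H B) (comult H h) (\<lambda>h1 h2.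
          sweedler (tensor K H B) (coact (act h1 b)) (\<lambda>x b0.
            pure_tensor K H B (x \<otimes>\<^bsub>H\<^esub> h2) b0))"
    and braided_antipode: "\<exists>S. convolution_inverses K B B (\<lambda>b. b) S"

text \<open>
  The underlying vector space of the biproduct is \<open>T = B \<otimes> H\<close>; tensors over \<open>T\<close> may be used for
  tensors over the biproduct, because \<open>tensor_eq\<close> depends only on the vector space structure.
\<close>

definition biproduct ::
    "('k, 'l) ring_scheme \<Rightarrow> ('k, 'h, 'm) hopf_scheme \<Rightarrow> ('k, 'b, 'n) hopf_scheme
      \<Rightarrow> ('h \<Rightarrow> 'b \<Rightarrow> 'b) \<Rightarrow> ('b \<Rightarrow> ('h \<times> 'b) list set)
      \<Rightarrow> ('k, ('b \<times> 'h) list set) hopf" where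
  "biproduct K H B act coact =
    (let T = tensor K B H; TT = tensor K T T in
    \<lparr> carrier = carrier T,
      mult = (\<lambda>X Y.
        sweedler T X (\<lambda>b h. sweedler T Y (\<lambda>b' h'. sweedler T (comult H h) (\<lambda>h1 h2.
          pure_tensor K B H (b \<otimes>\<^bsub>B\<^esub> act h1 b') (h2 \<otimes>\<^bsub>H\<^esub> h'))))),
      one = pure_tensor K B H \<one>\<^bsub>B\<^esub> \<one>\<^bsub>H\<^esub>,
      zero = zero T,
      add = add T,
      smult = smult T,
      comult = (\<lambda>X.
        sweedler TT X (\<lambda>b h. sweedler TT (comult B b) (\<lambda>b1 b2. sweedler TT (coact b2) (\<lambda>x b20.
          sweedler TT (comult H h) (\<lambda>h1 h2.
            pure_tensor K T T
              (pure_tensor K B H b1 (x \<otimes>\<^bsub>H\<^esub> h1)) (pure_tensor K B H b20 h2)))))),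
      counit = (\<lambda>X. sweedler K X (\<lambda>b h. counit B b \<otimes>\<^bsub>K\<^esub> counit H h)) \<rparr>)"

definition proj_H ::
    "('k, 'h, 'm) hopf_scheme \<Rightarrow> ('k, 'b, 'n) hopf_scheme \<Rightarrow> ('b \<times> 'h) list set \<Rightarrow> 'h" where
  "proj_H H B X = sweedler H X (\<lambda>b h. counit B b \<odot>\<^bsub>H\<^esub> h)"

definition incl_H ::
    "('k, 'l) ring_scheme \<Rightarrow> ('k, 'h, 'm) hopf_scheme \<Rightarrow> ('k, 'b, 'n) hopf_scheme
      \<Rightarrow> 'h \<Rightarrow> ('b \<times> 'h) list set" where
  "incl_H K H B h = pure_tensor K B H \<one>\<^bsub>B\<^esub> h"

definition proj_B ::
    "('k, 'h, 'm) hopf_scheme \<Rightarrow> ('k, 'b, 'n) hopf_scheme \<Rightarrow> ('b \<times> 'h) list set \<Rightarrow> 'b" where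
  "proj_B H B X = sweedler B X (\<lambda>b h. counit H h \<odot>\<^bsub>B\<^esub> b)"

definition incl_B ::
    "('k, 'l) ring_scheme \<Rightarrow> ('k, 'h, 'm) hopf_scheme \<Rightarrow> ('k, 'b, 'n) hopf_scheme
      \<Rightarrow> 'b \<Rightarrow> ('b \<times> 'h) list set" where
  "incl_B K H B b = pure_tensor K B H b \<one>\<^bsub>H\<^esub>"

definition End_Hopf ::
    "('k, 'l) ring_scheme \<Rightarrow> ('k, 'a, 'm) hopf_scheme \<Rightarrow> ('a \<Rightarrow> 'h) \<Rightarrow> ('a \<Rightarrow> 'a) set" where
  "End_Hopf K A p = {F. hopf_map K A A F \<and> (\<forall>a \<in> carrier A. p (F a) = p a)}"

definition left_part ::
    "('k, 'l) ring_scheme \<Rightarrow> ('k, 'h, 'm) hopf_scheme \<Rightarrow> ('k, 'b, 'n) hopf_scheme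
      \<Rightarrow> (('b \<times> 'h) list set \<Rightarrow> ('b \<times> 'h) list set) \<Rightarrow> 'b \<Rightarrow> 'b" where
  "left_part K H B F = proj_B H B \<circ> F \<circ> incl_B K H B"

definition right_part ::
    "('k, 'l) ring_scheme \<Rightarrow> ('k, 'h, 'm) hopf_scheme \<Rightarrow> ('k, 'b, 'n) hopf_scheme
      \<Rightarrow> (('b \<times> 'h) list set \<Rightarrow> ('b \<times> 'h) list set) \<Rightarrow> 'h \<Rightarrow> 'b" where
  "right_part K H B F = proj_B H B \<circ> F \<circ> incl_H K H B"

end

theory Submission
  imports Defs
begin

text \<open>
  Write \<open>A = B \<times> H\<close>.  The space \<open>B\<close> is a left \<open>A\<close>-module through
  \<open>(b \<times> h) \<rhd> c = b(h \<cdot> c)\<close>; associativity is the module algebra axiom.  The projection is the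
  orbit map \<open>\<Pi>(X) = X \<rhd> 1\<close>, hence \<open>\<Pi>(XY) = X \<rhd> \<Pi>(Y)\<close>.  The action of \<open>H\<close> on \<open>B\<close> is the
  pullback of \<open>\<rhd>\<close> along \<open>j\<close>, and pulling back along \<open>F \<circ> j\<close> gives a second one.

  Every \<open>X\<close> in \<open>A\<close> equals \<open>\<Pi>(X\<^sub>(\<^sub>1\<^sub>)) \<times> \<pi>(X\<^sub>(\<^sub>2\<^sub>))\<close>.  As \<open>F\<close> is a coalgebra map with
  \<open>\<pi> \<circ> F = \<pi>\<close>, this gives \<open>F(1 \<times> h) = F\<^sub>R(h\<^sub>(\<^sub>1\<^sub>)) \<times> h\<^sub>(\<^sub>2\<^sub>)\<close> and
  \<open>F(b \<times> 1) = F\<^sub>L(b) \<times> 1\<close>.  Applying \<open>\<Pi> \<circ> F\<close> to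
  \<open>(1 \<times> h)(b \<times> 1) = (h\<^sub>(\<^sub>1\<^sub>) \<cdot> b \<times> 1)(1 \<times> h\<^sub>(\<^sub>2\<^sub>))\<close> yields, for every \<open>F\<close>, the identity
  \<open>F\<^sub>R(h\<^sub>(\<^sub>1\<^sub>))(h\<^sub>(\<^sub>2\<^sub>) \<cdot> F\<^sub>L(b)) = F\<^sub>L(h\<^sub>(\<^sub>1\<^sub>) \<cdot> b)F\<^sub>R(h\<^sub>(\<^sub>2\<^sub>))\<close>  (lemma \<open>twisted_linearity\<close>).

  If \<open>F\<^sub>L\<close> is \<open>H\<close>-linear, then \<open>h\<^sub>(\<^sub>2\<^sub>) \<cdot> F\<^sub>L(b)\<close> may be replaced by \<open>F\<^sub>L(h\<^sub>(\<^sub>2\<^sub>) \<cdot> b)\<close>, which is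
  the commutation rule of part (a).  Conversely, the commutation rule shows that
  \<open>h \<mapsto> h \<cdot> F\<^sub>L(b)\<close> and \<open>h \<mapsto> F\<^sub>L(h \<cdot> b)\<close> have the same convolution product with \<open>F\<^sub>R\<close> on the left,
  and \<open>F\<^sub>R\<close> can be cancelled (lemma \<open>F\<^sub>R_left_cancel\<close>).  Part (b) follows because the commutation
  rule holds trivially when \<open>B\<close> is commutative and \<open>H\<close> is cocommutative.

  The proof replaces Sweedler sums by linear maps on tensor products: \<open>sweedler U X f\<close> is linear in
  \<open>X\<close> when \<open>f\<close> is bilinear, and linear maps can be pulled into the sum.
\<close>

section \<open>Linear and bilinear maps\<close>

definition bilinear_map ::
    "('k, 'l) ring_scheme \<Rightarrow> ('k, 'a, 'm) module_scheme \<Rightarrow> ('k, 'b, 'n) module_scheme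
      \<Rightarrow> ('k, 'u, 'o) module_scheme \<Rightarrow> ('a \<Rightarrow> 'b \<Rightarrow> 'u) \<Rightarrow> bool" where
  "bilinear_map K V W U f \<longleftrightarrow>
    (\<forall>v \<in> carrier V. linear_map K W U (f v)) \<and> (\<forall>w \<in> carrier W. linear_map K V U (\<lambda>v. f v w))"

lemma linear_mapI:
  assumes "\<And>x. x \<in> carrier V \<Longrightarrow> f x \<in> carrier W"
    and "\<And>x y. x \<in> carrier V \<Longrightarrow> y \<in> carrier V \<Longrightarrow> f (x \<oplus>\<^bsub>V\<^esub> y) = f x \<oplus>\<^bsub>W\<^esub> f y"
    and "\<And>a x. a \<in> carrier K \<Longrightarrow> x \<in> carrier V \<Longrightarrow> f (a \<odot>\<^bsub>V\<^esub> x) = a \<odot>\<^bsub>W\<^esub> f x"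
  shows "linear_map K V W f"
  using assms unfolding linear_map_def by auto

lemma linear_mapD:
  assumes "linear_map K V W f"
  shows linear_map_closed: "x \<in> carrier V \<Longrightarrow> f x \<in> carrier W"
    and linear_map_add: "x \<in> carrier V \<Longrightarrow> y \<in> carrier V \<Longrightarrow> f (x \<oplus>\<^bsub>V\<^esub> y) = f x \<oplus>\<^bsub>W\<^esub> f y"
    and linear_map_smult: "a \<in> carrier K \<Longrightarrow> x \<in> carrier V \<Longrightarrow> f (a \<odot>\<^bsub>V\<^esub> x) = a \<odot>\<^bsub>W\<^esub> f x"
  using assms unfolding linear_map_def by auto

lemma linear_map_zero:
  assumes "module K V" "module K W" "linear_map K V W f"
  shows "f \<zero>\<^bsub>V\<^esub> = \<zero>\<^bsub>W\<^esub>"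
proof -
  interpret V: module K V by fact
  interpret W: module K W by fact
  have "f (\<zero>\<^bsub>K\<^esub> \<odot>\<^bsub>V\<^esub> \<zero>\<^bsub>V\<^esub>) = \<zero>\<^bsub>K\<^esub> \<odot>\<^bsub>W\<^esub> f \<zero>\<^bsub>V\<^esub>"
    using linear_map_smult[OF assms(3)] by blast
  then show ?thesis using linear_map_closed[OF assms(3)] by simp
qed

lemma linear_map_id: "linear_map K V V (\<lambda>x. x)"
  unfolding linear_map_def by auto

lemma linear_map_comp:
  assumes "linear_map K W U g" "linear_map K V W f"
  shows "linear_map K V U (\<lambda>x. g (f x))"
  using assms unfolding linear_map_def by (auto simp: Pi_iff)

lemma bilinear_mapI:
  assumes "\<And>v. v \<in> carrier V \<Longrightarrow> linear_map K W U (f v)"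
    and "\<And>w. w \<in> carrier W \<Longrightarrow> linear_map K V U (\<lambda>v. f v w)"
  shows "bilinear_map K V W U f"
  using assms unfolding bilinear_map_def by auto

lemma bilinear_mapD:
  assumes "bilinear_map K V W U f"
  shows bilinear_map_right: "v \<in> carrier V \<Longrightarrow> linear_map K W U (f v)"
    and bilinear_map_left: "w \<in> carrier W \<Longrightarrow> linear_map K V U (\<lambda>v. f v w)"
    and bilinear_map_closed: "v \<in> carrier V \<Longrightarrow> w \<in> carrier W \<Longrightarrow> f v w \<in> carrier U"
  using assms unfolding bilinear_map_def by (auto dest: linear_map_closed)

section \<open>Tensor products\<close>

text \<open>
  The sum behind \<open>sweedler\<close> for one formal representative, so that invariance under \<open>tensor_eq\<close>
  becomes a statement about lists.
\<close>

definition formal_eval :: "('u, 'z) ring_scheme \<Rightarrow> ('a \<Rightarrow> 'b \<Rightarrow> 'u) \<Rightarrow> ('a \<times> 'b) list \<Rightarrow> 'u" where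
  "formal_eval U f xs = foldr (\<lambda>(v, w) s. f v w \<oplus>\<^bsub>U\<^esub> s) xs \<zero>\<^bsub>U\<^esub>"

lemma formal_eval_Nil [simp]: "formal_eval U f [] = \<zero>\<^bsub>U\<^esub>"
  and formal_eval_Cons [simp]:
    "formal_eval U f ((v, w) # xs) = f v w \<oplus>\<^bsub>U\<^esub> formal_eval U f xs"
  by (simp_all add: formal_eval_def)

lemma formal_sums_simps [simp]:
  "[] \<in> formal_sums V W"
  "(v, w) # xs \<in> formal_sums V W \<longleftrightarrow> v \<in> carrier V \<and> w \<in> carrier W \<and> xs \<in> formal_sums V W"
  "xs @ ys \<in> formal_sums V W \<longleftrightarrow> xs \<in> formal_sums V W \<and> ys \<in> formal_sums V W"
  by (auto simp: formal_sums_def)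

lemma formal_sums_induct [consumes 1, case_names Nil Cons]:
  assumes "xs \<in> formal_sums V W" and "P []"
    and "\<And>v w xs. v \<in> carrier V \<Longrightarrow> w \<in> carrier W \<Longrightarrow> xs \<in> formal_sums V W \<Longrightarrow> P xs \<Longrightarrow>
      P ((v, w) # xs)"
  shows "P xs"
  using assms(1) by (induction xs) (use assms(2-) in auto)

lemma formal_eval_cong:
  assumes "xs \<in> formal_sums V W"
    and "\<And>v w. v \<in> carrier V \<Longrightarrow> w \<in> carrier W \<Longrightarrow> f v w = g v w"
  shows "formal_eval U f xs = formal_eval U g xs"
  using assms(1) by (induction rule: formal_sums_induct) (auto simp: assms(2))

lemma formal_eval_closed:
  assumes "abelian_monoid U" "xs \<in> formal_sums V W"
    and "\<And>v w. v \<in> carrier V \<Longrightarrow> w \<in> carrier W \<Longrightarrow> f v w \<in> carrier U"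
  shows "formal_eval U f xs \<in> carrier U"
proof -
  interpret abelian_monoid U by fact
  show ?thesis using assms(2) by (induction rule: formal_sums_induct) (auto simp: assms(3))
qed

lemma formal_eval_append:
  assumes "abelian_monoid U" "xs \<in> formal_sums V W" "ys \<in> formal_sums V W"
    and f: "\<And>v w. v \<in> carrier V \<Longrightarrow> w \<in> carrier W \<Longrightarrow> f v w \<in> carrier U"
  shows "formal_eval U f (xs @ ys) = formal_eval U f xs \<oplus>\<^bsub>U\<^esub> formal_eval U f ys"
proof -
  interpret abelian_monoid U by fact
  note closed = formal_eval_closed[where f = f, OF assms(1) _ f]
  show ?thesis using assms(2)
    by (induction rule: formal_sums_induct) (auto simp: f closed[OF assms(3)] closed a_assoc)
qed

lemma linear_formal_eval:
  assumes "module K U" "module K U'" "linear_map K U U' g" "xs \<in> formal_sums V W"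
    and f: "\<And>v w. v \<in> carrier V \<Longrightarrow> w \<in> carrier W \<Longrightarrow> f v w \<in> carrier U"
  shows "g (formal_eval U f xs) = formal_eval U' (\<lambda>v w. g (f v w)) xs"
proof -
  interpret U: module K U by fact
  show ?thesis using assms(4)
    by (induction rule: formal_sums_induct)
      (auto simp: f linear_map_zero[OF assms(1-3)] linear_map_add[OF assms(3)]
        formal_eval_closed[where f = f, OF U.abelian_monoid_axioms _ f])
qed

lemma tensor_eq_formal_sums:
  assumes "module K V" "module K W" "tensor_eq K V W xs ys"
  shows "xs \<in> formal_sums V W \<and> ys \<in> formal_sums V W"
proof -
  interpret V: module K V by fact
  interpret W: module K W by fact
  show ?thesis using assms(3) by induction auto
qed

text \<open>
  Each relation defining the tensor product is respected by bilinear maps; this is the universal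
  property.
\<close>

lemma formal_eval_tensor_eq:
  assumes "module K V" "module K W" "module K U" "bilinear_map K V W U f"
    and "tensor_eq K V W xs ys"
  shows "formal_eval U f xs = formal_eval U f ys"
proof -
  interpret V: module K V by fact
  interpret W: module K W by fact
  interpret U: module K U by fact
  note fs = tensor_eq_formal_sums[OF assms(1,2)]
  note f = bilinear_map_closed[OF assms(4)]
  note app = formal_eval_append[where f = f and V = V and W = W, OF U.abelian_monoid_axioms _ _ f]
  note cl = formal_eval_closed[where f = f and V = V and W = W, OF U.abelian_monoid_axioms _ f]
  note r = bilinear_map_right[OF assms(4)] and l = bilinear_map_left[OF assms(4)]
  show ?thesis using assms(5)
  proof induction
    case (append xs xs' ys ys')
    then show ?case using fs[of xs xs'] fs[of ys ys'] by (simp add: app)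
  next
    case (commute xs ys)
    then show ?case by (simp add: app cl U.a_comm)
  next
    case (zero w)
    then show ?case using linear_map_zero[OF assms(1,3) l, of w] by simp
  next
    case (add_left v v' w)
    then show ?case using linear_map_add[OF l, of w v v'] f by (simp add: U.a_assoc)
  next
    case (add_right v w w')
    then show ?case using linear_map_add[OF r, of v w w'] f by (simp add: U.a_assoc)
  next
    case (smult a v w)
    then show ?case using linear_map_smult[OF l, of w a v] linear_map_smult[OF r, of v a w] by simp
  qed auto
qed

locale module_pair = V: module K V + W: module K W
  for K :: "('k, 'l) ring_scheme" and V :: "('k, 'a, 'm) module_scheme"
    and W :: "('k, 'b, 'n) module_scheme"
begin

abbreviation "VW \<equiv> tensor K V W"
abbreviation "cls \<equiv> tensor_class K V W"
abbreviation "teq \<equiv> tensor_eq K V W"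

lemmas fs = tensor_eq_formal_sums[OF V.module_axioms W.module_axioms]

lemma class_eqI: "teq xs ys \<Longrightarrow> cls xs = cls ys"
  unfolding tensor_class_def by (auto intro: tensor_eq.trans tensor_eq.sym)

lemma rep_teq: "xs \<in> formal_sums V W \<Longrightarrow> teq (tensor_rep (cls xs)) xs"
  unfolding tensor_rep_def tensor_class_def
  by (rule someI2[of _ xs]) (auto intro: tensor_eq.refl tensor_eq.sym)

lemma rep_formal_sums [simp]: "xs \<in> formal_sums V W \<Longrightarrow> tensor_rep (cls xs) \<in> formal_sums V W"
  using rep_teq fs by blast

lemma carrier_tensor: "X \<in> carrier VW \<longleftrightarrow> (\<exists>xs \<in> formal_sums V W. X = cls xs)"
  by (auto simp: tensor_def)

lemma tensorE:
  assumes "X \<in> carrier VW" obtains xs where "xs \<in> formal_sums V W" "X = cls xs"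
  using assms carrier_tensor by blast

lemma class_closed [simp]: "xs \<in> formal_sums V W \<Longrightarrow> cls xs \<in> carrier VW"
  using carrier_tensor by blast

lemma zero_tensor: "\<zero>\<^bsub>VW\<^esub> = cls []"
  by (simp add: tensor_def)

lemma add_class:
  "xs \<in> formal_sums V W \<Longrightarrow> ys \<in> formal_sums V W \<Longrightarrow> cls xs \<oplus>\<^bsub>VW\<^esub> cls ys = cls (xs @ ys)"
  by (simp add: tensor_def) (intro class_eqI tensor_eq.append rep_teq)

lemma add_class_comm:
  "xs \<in> formal_sums V W \<Longrightarrow> ys \<in> formal_sums V W \<Longrightarrow> cls (xs @ ys) = cls (ys @ xs)"
  by (intro class_eqI tensor_eq.commute)

definition scale :: "'k \<Rightarrow> ('a \<times> 'b) list \<Rightarrow> ('a \<times> 'b) list" where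
  "scale a = map (\<lambda>(v, w). (a \<odot>\<^bsub>V\<^esub> v, w))"

lemma scale_simps [simp]:
  "scale a [] = []" "scale a ((v, w) # xs) = (a \<odot>\<^bsub>V\<^esub> v, w) # scale a xs"
  "scale a (xs @ ys) = scale a xs @ scale a ys"
  by (simp_all add: scale_def)

lemma scale_closed [simp]:
  assumes "a \<in> carrier K" "xs \<in> formal_sums V W"
  shows "scale a xs \<in> formal_sums V W"
  using assms(2) by (induction rule: formal_sums_induct) (auto simp: assms(1))

lemma scale_teq:
  assumes "a \<in> carrier K" "teq xs ys"
  shows "teq (scale a xs) (scale a ys)"
  using assms(2)
proof induction
  case (refl xs)
  then show ?case using assms(1) by (auto intro: tensor_eq.refl)
next
  case (zero w)
  then show ?case using assms(1) by (auto intro: tensor_eq.zero)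
next
  case (add_left v v' w)
  then show ?case using assms(1) by (auto simp: V.smult_r_distr intro: tensor_eq.add_left)
next
  case (add_right v w w')
  then show ?case using assms(1) by (auto intro: tensor_eq.add_right)
next
  case (smult b v w)
  have "a \<odot>\<^bsub>V\<^esub> (b \<odot>\<^bsub>V\<^esub> v) = b \<odot>\<^bsub>V\<^esub> (a \<odot>\<^bsub>V\<^esub> v)"
    using smult assms(1) V.R.m_comm by (metis V.smult_assoc1)
  then show ?case using smult assms(1) by (auto intro: tensor_eq.smult)
qed (auto intro: tensor_eq.intros simp: assms(1))

lemma smult_class:
  "a \<in> carrier K \<Longrightarrow> xs \<in> formal_sums V W \<Longrightarrow> a \<odot>\<^bsub>VW\<^esub> cls xs = cls (scale a xs)"
  by (simp add: tensor_def flip: scale_def) (intro class_eqI scale_teq rep_teq)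

lemma Cons_teq:
  assumes "teq [(v, w)] ys" "teq xs zs"
  shows "teq ((v, w) # xs) (ys @ zs)"
  using tensor_eq.append[OF assms] by simp

lemma scale_zero: "xs \<in> formal_sums V W \<Longrightarrow> teq (scale \<zero>\<^bsub>K\<^esub> xs) []"
proof (induction rule: formal_sums_induct)
  case (Cons v w xs)
  then show ?case using Cons_teq[OF tensor_eq.zero[of w W K V] Cons.IH] by simp
qed (auto intro: tensor_eq.refl)

text \<open>
  The interleaved summands coming from bilinearity have to be reordered before the induction
  hypothesis applies.
\<close>

lemma scale_add:
  assumes "a \<in> carrier K" "b \<in> carrier K" "xs \<in> formal_sums V W"
  shows "cls (scale (a \<oplus>\<^bsub>K\<^esub> b) xs) = cls (scale a xs) \<oplus>\<^bsub>VW\<^esub> cls (scale b xs)"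
proof -
  have "teq (scale (a \<oplus>\<^bsub>K\<^esub> b) xs) (scale a xs @ scale b xs)"
    using assms(3)
  proof (induction rule: formal_sums_induct)
    case (Cons v w xs)
    let ?a = "(a \<odot>\<^bsub>V\<^esub> v, w)" and ?b = "(b \<odot>\<^bsub>V\<^esub> v, w)"
    have 1: "teq (scale (a \<oplus>\<^bsub>K\<^esub> b) ((v, w) # xs)) ([?a, ?b] @ (scale a xs @ scale b xs))"
      using Cons Cons_teq[OF tensor_eq.add_left Cons.IH] assms by (simp add: V.smult_l_distr)
    have "teq ([?b] @ scale a xs) (scale a xs @ [?b])"
      using Cons assms by (intro tensor_eq.commute) auto
    from tensor_eq.append[OF this tensor_eq.refl[of "scale b xs"]]
    have "teq (([?b] @ scale a xs) @ scale b xs) ((scale a xs @ [?b]) @ scale b xs)"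
      using Cons assms by simp
    from tensor_eq.append[OF tensor_eq.refl[of "[?a]"] this]
    have "teq ([?a] @ (([?b] @ scale a xs) @ scale b xs))
        ([?a] @ ((scale a xs @ [?b]) @ scale b xs))"
      using Cons assms by simp
    with 1 show ?case by (auto intro: tensor_eq.trans)
  qed (auto intro: tensor_eq.refl)
  then show ?thesis using assms by (simp add: add_class class_eqI)
qed

lemma scale_mult:
  assumes "a \<in> carrier K" "b \<in> carrier K" "xs \<in> formal_sums V W"
  shows "scale (a \<otimes>\<^bsub>K\<^esub> b) xs = scale a (scale b xs)"
  using assms(3) by (induction rule: formal_sums_induct) (auto simp: V.smult_assoc1 assms)

lemma scale_one: "xs \<in> formal_sums V W \<Longrightarrow> scale \<one>\<^bsub>K\<^esub> xs = xs"
  by (induction rule: formal_sums_induct) auto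

lemma module_tensor: "module K VW"
proof (rule moduleI)
  show "cring K" by (rule V.R.is_cring)
  show "abelian_group VW"
  proof (rule abelian_groupI)
    \<comment> \<open>Formal sums have no negatives; the inverse of \<open>X\<close> is \<open>-1\<close> times \<open>X\<close>.\<close>
    fix X assume "X \<in> carrier VW"
    then obtain xs where xs: "xs \<in> formal_sums V W" "X = cls xs" by (rule tensorE)
    let ?ys = "scale (\<ominus>\<^bsub>K\<^esub> \<one>\<^bsub>K\<^esub>) xs"
    have "cls ?ys \<oplus>\<^bsub>VW\<^esub> X = cls (scale (\<ominus>\<^bsub>K\<^esub> \<one>\<^bsub>K\<^esub> \<oplus>\<^bsub>K\<^esub> \<one>\<^bsub>K\<^esub>) xs)"
      using xs scale_add[of "\<ominus>\<^bsub>K\<^esub> \<one>\<^bsub>K\<^esub>" "\<one>\<^bsub>K\<^esub>" xs] by (simp add: scale_one)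
    also have "\<dots> = \<zero>\<^bsub>VW\<^esub>"
      using xs class_eqI[OF scale_zero] by (simp add: V.R.l_neg zero_tensor)
    finally show "\<exists>Y \<in> carrier VW. Y \<oplus>\<^bsub>VW\<^esub> X = \<zero>\<^bsub>VW\<^esub>"
      using xs by (intro bexI[of _ "cls ?ys"]) auto
  qed (auto elim!: tensorE simp: add_class zero_tensor add_class_comm)
qed (auto elim!: tensorE
      simp: smult_class add_class scale_add scale_mult scale_one)

lemma sweedler_formal_eval: "sweedler U X f = formal_eval U f (tensor_rep X)"
  by (simp add: sweedler_def formal_eval_def)

lemma rep_closed: "X \<in> carrier VW \<Longrightarrow> tensor_rep X \<in> formal_sums V W"
  by (auto elim: tensorE)

lemma sweedler_class:
  assumes "module K U" "bilinear_map K V W U f" "xs \<in> formal_sums V W"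
  shows "sweedler U (cls xs) f = formal_eval U f xs"
  unfolding sweedler_formal_eval
  by (rule formal_eval_tensor_eq[OF V.module_axioms W.module_axioms assms(1,2) rep_teq[OF assms(3)]])

lemma pure_closed: "v \<in> carrier V \<Longrightarrow> w \<in> carrier W \<Longrightarrow> pure_tensor K V W v w \<in> carrier VW"
  by (simp add: pure_tensor_def)

lemma sweedler_pure:
  assumes "module K U" "bilinear_map K V W U f" "v \<in> carrier V" "w \<in> carrier W"
  shows "sweedler U (pure_tensor K V W v w) f = f v w"
proof -
  interpret U: module K U by fact
  show ?thesis using assms(3,4) bilinear_map_closed[OF assms(2-)]
    by (simp add: pure_tensor_def sweedler_class[OF assms(1,2)])
qed

lemma sweedler_closed:
  assumes "module K U" "X \<in> carrier VW"
    and "\<And>v w. v \<in> carrier V \<Longrightarrow> w \<in> carrier W \<Longrightarrow> f v w \<in> carrier U"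
  shows "sweedler U X f \<in> carrier U"
proof -
  interpret U: module K U by fact
  show ?thesis unfolding sweedler_formal_eval
    by (rule formal_eval_closed[OF U.abelian_monoid_axioms rep_closed[OF assms(2)] assms(3)])
qed

lemma sweedler_cong:
  assumes "X \<in> carrier VW"
    and "\<And>v w. v \<in> carrier V \<Longrightarrow> w \<in> carrier W \<Longrightarrow> f v w = g v w"
  shows "sweedler U X f = sweedler U X g"
  unfolding sweedler_formal_eval by (rule formal_eval_cong[OF rep_closed[OF assms(1)] assms(2)])

lemma linear_sweedler:
  assumes "module K U" "module K U'" "linear_map K U U' g" "X \<in> carrier VW"
    and "\<And>v w. v \<in> carrier V \<Longrightarrow> w \<in> carrier W \<Longrightarrow> f v w \<in> carrier U"
  shows "g (sweedler U X f) = sweedler U' X (\<lambda>v w. g (f v w))"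
  unfolding sweedler_formal_eval
  by (rule linear_formal_eval[OF assms(1-3) rep_closed[OF assms(4)] assms(5)])

lemma sweedler_linear:
  assumes "module K U" "bilinear_map K V W U f"
  shows "linear_map K VW U (\<lambda>X. sweedler U X f)"
proof -
  interpret U: module K U by fact
  note f = bilinear_map_closed[OF assms(2)]
  show ?thesis
  proof (rule linear_mapI)
    fix a X assume a: "a \<in> carrier K" and "X \<in> carrier VW"
    from this(2) obtain xs where xs: "xs \<in> formal_sums V W" "X = cls xs" by (rule tensorE)
    have "formal_eval U f (scale a xs) = a \<odot>\<^bsub>U\<^esub> formal_eval U f xs"
      using xs(1)
    proof (induction rule: formal_sums_induct)
      case (Cons v w xs)
      then show ?case
        using a f formal_eval_closed[where f = f, OF U.abelian_monoid_axioms Cons(3) f]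
          linear_map_smult[OF bilinear_map_left[OF assms(2)], of w a v]
        by (auto simp: U.smult_r_distr)
    qed (use a in auto)
    then show "sweedler U (a \<odot>\<^bsub>VW\<^esub> X) f = a \<odot>\<^bsub>U\<^esub> sweedler U X f"
      using xs a by (simp add: smult_class sweedler_class[OF assms])
  next
    fix X Y assume "X \<in> carrier VW" "Y \<in> carrier VW"
    then show "sweedler U (X \<oplus>\<^bsub>VW\<^esub> Y) f = sweedler U X f \<oplus>\<^bsub>U\<^esub> sweedler U Y f"
      by (auto elim!: tensorE simp: add_class sweedler_class[OF assms]
          formal_eval_append[where f = f, OF U.abelian_monoid_axioms _ _ f])
  qed (intro sweedler_closed assms f)
qed

lemma pure_bilinear: "bilinear_map K V W VW (pure_tensor K V W)"
  unfolding pure_tensor_def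
proof (intro bilinear_mapI linear_mapI, goal_cases)
  case (2 v w w')
  then show ?case by (simp add: add_class) (intro class_eqI tensor_eq.add_right)
next
  case (3 v a w)
  then show ?case
    by (simp add: smult_class) (intro class_eqI tensor_eq.sym[OF tensor_eq.smult])
next
  case (5 w v v')
  then show ?case by (simp add: add_class) (intro class_eqI tensor_eq.add_left)
next
  case (6 w a v)
  then show ?case by (auto simp: smult_class)
qed auto

lemma pure_smult:
  "a \<in> carrier K \<Longrightarrow> v \<in> carrier V \<Longrightarrow> w \<in> carrier W \<Longrightarrow>
    pure_tensor K V W (a \<odot>\<^bsub>V\<^esub> v) w = pure_tensor K V W v (a \<odot>\<^bsub>W\<^esub> w)"
  unfolding pure_tensor_def by (intro class_eqI tensor_eq.smult)

lemma tensor_expand: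
  assumes "X \<in> carrier VW"
  shows "sweedler VW X (pure_tensor K V W) = X"
proof -
  obtain xs where xs: "xs \<in> formal_sums V W" "X = cls xs" using assms by (rule tensorE)
  have "formal_eval VW (pure_tensor K V W) xs = cls xs" using xs(1)
    by (induction rule: formal_sums_induct) (auto simp: zero_tensor pure_tensor_def add_class)
  then show ?thesis using xs by (simp add: sweedler_class[OF module_tensor pure_bilinear])
qed

text \<open>
  Pure tensors span.
\<close>

lemma linear_map_eqI:
  assumes "module K U" "linear_map K VW U f" "linear_map K VW U g" "X \<in> carrier VW"
    and "\<And>v w. v \<in> carrier V \<Longrightarrow> w \<in> carrier W \<Longrightarrow>
      f (pure_tensor K V W v w) = g (pure_tensor K V W v w)"
  shows "f X = g X"
proof -
  have "f X = sweedler U X (\<lambda>v w. f (pure_tensor K V W v w))"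
    using linear_sweedler[OF module_tensor assms(1,2,4), of "pure_tensor K V W"] assms(4)
    by (simp add: tensor_expand pure_closed)
  also have "\<dots> = sweedler U X (\<lambda>v w. g (pure_tensor K V W v w))"
    using assms by (intro sweedler_cong)
  also have "\<dots> = g X"
    using linear_sweedler[OF module_tensor assms(1,3,4), of "pure_tensor K V W"] assms(4)
    by (simp add: tensor_expand pure_closed)
  finally show ?thesis .
qed

text \<open>
  Linearity in a parameter of the summands, as opposed to linearity in the tensor.
\<close>

lemma linear_map_sweedler:
  assumes "module K Z" "module K U" "X \<in> carrier VW"
    and "\<And>v w. v \<in> carrier V \<Longrightarrow> w \<in> carrier W \<Longrightarrow> linear_map K Z U (\<lambda>z. f z v w)"
  shows "linear_map K Z U (\<lambda>z. sweedler U X (f z))"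
proof -
  interpret U: module K U by fact
  interpret Z: module K Z by fact
  have "linear_map K Z U (\<lambda>z. formal_eval U (f z) xs)" if "xs \<in> formal_sums V W" for xs
    using that
  proof (induction rule: formal_sums_induct)
    case Nil
    show ?case by (rule linear_mapI) auto
  next
    case (Cons v w xs)
    note r = linear_mapD[OF Cons.IH] and l = linear_mapD[OF assms(4)[OF Cons(1,2)]]
    show ?case
      by (rule linear_mapI) (auto simp: r l U.add.m_ac U.smult_r_distr)
  qed
  then show ?thesis unfolding sweedler_formal_eval using rep_closed[OF assms(3)] .
qed

end

text \<open>
  The congruence depends only on the vector space structures.  It is applied to the biproduct and
  its underlying tensor product, which are different records.
\<close>

lemma tensor_eq_transfer:
  assumes "carrier V = carrier V'" "zero V = zero V'" "add V = add V'"
      "module.smult V = module.smult V'"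
    and "carrier W = carrier W'" "zero W = zero W'" "add W = add W'"
      "module.smult W = module.smult W'"
    and "tensor_eq K V W xs ys"
  shows "tensor_eq K V' W' xs ys"
  using assms(9)
  by induction (use assms(1-8) in \<open>auto intro: tensor_eq.intros simp: formal_sums_def\<close>)

lemma linear_map_pure_left:
  assumes "module K V" "module K W" "linear_map K Z V g" "w \<in> carrier W"
  shows "linear_map K Z (tensor K V W) (\<lambda>z. pure_tensor K V W (g z) w)"
proof -
  interpret V: module K V by fact
  interpret W: module K W by fact
  interpret module_pair K V W ..
  show ?thesis
    using linear_map_comp[OF bilinear_map_left[OF pure_bilinear assms(4)] assms(3)] .
qed

lemma linear_map_pure_right:
  assumes "module K V" "module K W" "linear_map K Z W g" "v \<in> carrier V"
  shows "linear_map K Z (tensor K V W) (\<lambda>z. pure_tensor K V W v (g z))"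
proof -
  interpret V: module K V by fact
  interpret W: module K W by fact
  interpret module_pair K V W ..
  show ?thesis
    using linear_map_comp[OF bilinear_map_right[OF pure_bilinear assms(4)] assms(3)] .
qed

lemma linear_map_smult_right:
  assumes "module K V" "linear_map K Z V g" "a \<in> carrier K"
  shows "linear_map K Z V (\<lambda>z. a \<odot>\<^bsub>V\<^esub> g z)"
proof -
  interpret V: module K V by fact
  note g = linear_mapD[OF assms(2)]
  show ?thesis
    using assms(3) by (intro linear_mapI)
      (auto simp: g V.smult_r_distr V.R.m_comm simp flip: V.smult_assoc1)
qed

lemma linear_map_smult_left:
  assumes "module K V" "linear_map K Z (scalars K) g" "v \<in> carrier V"
  shows "linear_map K Z V (\<lambda>z. g z \<odot>\<^bsub>V\<^esub> v)"
proof -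
  interpret V: module K V by fact
  note g = linear_mapD[OF assms(2), unfolded scalars_def, simplified]
  show ?thesis
    using assms(3) by (intro linear_mapI)
      (auto simp: g V.smult_l_distr V.smult_assoc1)
qed

section \<open>Algebras, coalgebras and modules\<close>

context k_algebra
begin

lemma linear_map_mult_left:
  assumes "linear_map K Z A g" "x \<in> carrier A"
  shows "linear_map K Z A (\<lambda>z. g z \<otimes>\<^bsub>A\<^esub> x)"
proof -
  interpret ring A by (rule ring)
  note g = linear_mapD[OF assms(1)]
  show ?thesis using assms(2) by (intro linear_mapI) (auto simp: g l_distr smult_mult)
qed

lemma linear_map_mult_right:
  assumes "linear_map K Z A g" "x \<in> carrier A"
  shows "linear_map K Z A (\<lambda>z. x \<otimes>\<^bsub>A\<^esub> g z)"
proof -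
  interpret ring A by (rule ring)
  note g = linear_mapD[OF assms(1)]
  show ?thesis using assms(2) by (intro linear_mapI) (auto simp: g r_distr mult_smult)
qed

end

context k_coalgebra
begin

sublocale CC: module_pair K C C
  by (intro module_pair.intro module)

lemma comult_closed [simp]: "c \<in> carrier C \<Longrightarrow> comult C c \<in> carrier (tensor K C C)"
  using linear_map_closed[OF comult_linear] .

lemma counit_closed [simp]: "c \<in> carrier C \<Longrightarrow> counit C c \<in> carrier K"
  using linear_map_closed[OF counit_linear] by (simp add: scalars_def)

lemma linear_map_sweedler_comult:
  assumes "module K U" "linear_map K Z C g" "bilinear_map K C C U f"
  shows "linear_map K Z U (\<lambda>z. sweedler U (comult C (g z)) f)"
  using linear_map_comp[OF CC.sweedler_linear[OF assms(1,3)]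
      linear_map_comp[OF comult_linear assms(2)]] .

text \<open>
  Coassociativity in the form
  \<open>t(c\<^sub>(\<^sub>1\<^sub>)\<^sub>(\<^sub>1\<^sub>), c\<^sub>(\<^sub>1\<^sub>)\<^sub>(\<^sub>2\<^sub>), c\<^sub>(\<^sub>2\<^sub>)) = t(c\<^sub>(\<^sub>1\<^sub>), c\<^sub>(\<^sub>2\<^sub>)\<^sub>(\<^sub>1\<^sub>), c\<^sub>(\<^sub>2\<^sub>)\<^sub>(\<^sub>2\<^sub>))\<close>:
  apply the linear map \<open>T\<close> induced by \<open>t\<close> on the triple tensor product to the coassociativity axiom.
\<close>

lemma coassoc_trilinear:
  assumes U: "module K U" and c: "c \<in> carrier C"
    and t1: "\<And>y z. y \<in> carrier C \<Longrightarrow> z \<in> carrier C \<Longrightarrow> linear_map K C U (\<lambda>x. t x y z)"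
    and t2: "\<And>x z. x \<in> carrier C \<Longrightarrow> z \<in> carrier C \<Longrightarrow> linear_map K C U (\<lambda>y. t x y z)"
    and t3: "\<And>x y. x \<in> carrier C \<Longrightarrow> y \<in> carrier C \<Longrightarrow> linear_map K C U (\<lambda>z. t x y z)"
  shows "sweedler U (comult C c) (\<lambda>x y. sweedler U (comult C x) (\<lambda>x1 x2. t x1 x2 y)) =
    sweedler U (comult C c) (\<lambda>x y. sweedler U (comult C y) (t x))"
proof -
  interpret CCC: module_pair K C "tensor K C C"
    by (intro module_pair.intro module CC.module_tensor)
  let ?CC = "tensor K C C" and ?CCC = "tensor K C (tensor K C C)"
  define T where "T X = sweedler U X (\<lambda>x Y. sweedler U Y (t x))" for X
  have bil: "bilinear_map K C C U (t x)" if "x \<in> carrier C" for x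
    using that by (intro bilinear_mapI t2 t3)
  have biT: "bilinear_map K C ?CC U (\<lambda>x Y. sweedler U Y (t x))"
    by (intro bilinear_mapI CC.sweedler_linear CC.linear_map_sweedler U module bil t1)
  have T: "linear_map K ?CCC U T"
    unfolding T_def by (rule CCC.sweedler_linear[OF U biT])
  have pure: "T (pure_tensor K C ?CC x Y) = sweedler U Y (t x)"
    if "x \<in> carrier C" "Y \<in> carrier ?CC" for x Y
    unfolding T_def using CCC.sweedler_pure[OF U biT that] .
  have "T (sweedler ?CCC (comult C c) (\<lambda>x y. sweedler ?CCC (comult C x) (\<lambda>x1 x2.
          pure_tensor K C ?CC x1 (pure_tensor K C C x2 y)))) =
      sweedler U (comult C c) (\<lambda>x y. T (sweedler ?CCC (comult C x) (\<lambda>x1 x2.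
          pure_tensor K C ?CC x1 (pure_tensor K C C x2 y))))"
    by (intro CC.linear_sweedler[OF CCC.module_tensor U T]
        CC.sweedler_closed[OF CCC.module_tensor] comult_closed CCC.pure_closed CC.pure_closed c)
  also have "\<dots> = sweedler U (comult C c) (\<lambda>x y. sweedler U (comult C x) (\<lambda>x1 x2.
          T (pure_tensor K C ?CC x1 (pure_tensor K C C x2 y))))"
    by (intro CC.sweedler_cong CC.linear_sweedler[OF CCC.module_tensor U T]
        comult_closed CCC.pure_closed CC.pure_closed c)
  also have "\<dots> = sweedler U (comult C c) (\<lambda>x y. sweedler U (comult C x) (\<lambda>x1 x2. t x1 x2 y))"
    by (intro CC.sweedler_cong comult_closed c HOL.trans[OF pure CC.sweedler_pure[OF U bil]]
        CC.pure_closed)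
  finally have left: "T (sweedler ?CCC (comult C c) (\<lambda>x y. sweedler ?CCC (comult C x) (\<lambda>x1 x2.
          pure_tensor K C ?CC x1 (pure_tensor K C C x2 y)))) = \<dots>" .
  have "T (sweedler ?CCC (comult C c) (\<lambda>x y. pure_tensor K C ?CC x (comult C y))) =
      sweedler U (comult C c) (\<lambda>x y. T (pure_tensor K C ?CC x (comult C y)))"
    by (intro CC.linear_sweedler[OF CCC.module_tensor U T] comult_closed CCC.pure_closed c)
  also have "\<dots> = sweedler U (comult C c) (\<lambda>x y. sweedler U (comult C y) (t x))"
    by (intro CC.sweedler_cong comult_closed c pure)
  finally show ?thesis using left coassoc[OF c] by simp
qed

end

lemma linear_map_act_left:
  assumes "left_module K H M act" "linear_map K Z H g" "m \<in> carrier M"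
  shows "linear_map K Z M (\<lambda>z. act (g z) m)"
  using linear_map_comp[OF left_module.act_linear_left[OF assms(1,3)] assms(2)] .

lemma linear_map_act_right:
  assumes "left_module K H M act" "linear_map K Z M g" "h \<in> carrier H"
  shows "linear_map K Z M (\<lambda>z. act h (g z))"
  using linear_map_comp[OF left_module.act_linear[OF assms(1,3)] assms(2)] .

lemma left_module_pullback:
  assumes "left_module K A M act" "algebra_map K H A f"
  shows "left_module K H M (\<lambda>h. act (f h))"
proof -
  interpret left_module K A M act by fact
  have f: "linear_map K H A f" "f \<in> ring_hom H A"
    using assms(2) by (auto simp: algebra_map_def)
  note cl = linear_map_closed[OF f(1)]
  show ?thesis
    by unfold_locales (auto simp: act_linear act_mult act_one cl
        ring_hom_mult[OF f(2)] ring_hom_one[OF f(2)]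
        intro: linear_map_comp[OF act_linear_left f(1)])
qed

context k_hopf_algebra
begin

text \<open>
  If \<open>P\<close> is left convolution inverse to \<open>Q\<close>, then acting through \<open>P\<close> undoes acting through
  \<open>Q\<close> on linear maps \<open>X : H \<rightarrow> M\<close>: by coassociativity,
  \<open>P(h\<^sub>(\<^sub>1\<^sub>)) \<cdot> (Q(h\<^sub>(\<^sub>2\<^sub>)) \<cdot> X(h\<^sub>(\<^sub>3\<^sub>))) = (P(h\<^sub>(\<^sub>1\<^sub>))Q(h\<^sub>(\<^sub>2\<^sub>))) \<cdot> X(h\<^sub>(\<^sub>3\<^sub>)) = X(h)\<close>.  It is used with
  \<open>(P, Q) = (id, S)\<close> for one action of \<open>H\<close> on \<open>B\<close> and with \<open>(P, Q) = (S, id)\<close> for another.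
\<close>

lemma convolution_cancel:
  assumes M: "module K M" and "left_module K H M act"
    and P: "linear_map K H H P" and Q: "linear_map K H H Q"
    and inv: "\<And>h. h \<in> carrier H \<Longrightarrow>
      sweedler H (comult H h) (\<lambda>x y. P x \<otimes>\<^bsub>H\<^esub> Q y) = counit H h \<odot>\<^bsub>H\<^esub> \<one>\<^bsub>H\<^esub>"
    and X: "linear_map K H M X" and h: "h \<in> carrier H"
  shows "sweedler M (comult H h) (\<lambda>h1 h2. act (P h1)
      (sweedler M (comult H h2) (\<lambda>x y. act (Q x) (X y)))) = X h"
proof -
  interpret M: left_module K H M act by fact
  interpret H: ring H by (rule ring)
  interpret module K H by (rule module)
  note cl = linear_map_closed[OF P] linear_map_closed[OF Q] linear_map_closed[OF X]
    linear_map_closed[OF M.act_linear]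
  let ?D = "comult H"
  have "sweedler M (?D h) (\<lambda>h1 h2. act (P h1) (sweedler M (?D h2) (\<lambda>x y. act (Q x) (X y)))) =
      sweedler M (?D h) (\<lambda>h1 h2. sweedler M (?D h2) (\<lambda>x y. act (P h1) (act (Q x) (X y))))"
    by (intro CC.sweedler_cong CC.linear_sweedler[OF M M] M.act_linear) (auto simp: cl h)
  also have "\<dots> = sweedler M (?D h) (\<lambda>h1 h2. sweedler M (?D h1)
      (\<lambda>x y. act (P x) (act (Q y) (X h2))))"
    by (intro coassoc_trilinear[symmetric] M linear_map_act_left[OF assms(2)]
        linear_map_act_right[OF assms(2)] P Q X cl h)
  also have "\<dots> = sweedler M (?D h) (\<lambda>h1 h2. act (sweedler H (?D h1) (\<lambda>x y. P x \<otimes>\<^bsub>H\<^esub> Q y)) (X h2))"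
    by (intro CC.sweedler_cong,
        auto simp: h cl M.act_mult CC.linear_sweedler[OF module M M.act_linear_left]
        intro!: CC.sweedler_cong)
  also have "\<dots> = sweedler M (?D h) (\<lambda>h1 h2. X (counit H h1 \<odot>\<^bsub>H\<^esub> h2))"
    by (intro CC.sweedler_cong)
      (auto simp: h cl inv linear_map_smult[OF M.act_linear_left] linear_map_smult[OF X] M.act_one)
  also have "\<dots> = X (sweedler H (?D h) (\<lambda>h1 h2. counit H h1 \<odot>\<^bsub>H\<^esub> h2))"
    by (intro CC.linear_sweedler[symmetric, OF module M X]) (auto simp: h)
  finally show ?thesis using counit_left[OF h] by simp
qed

end

section \<open>The biproduct acts on its left factor\<close>

context biproduct_datum
begin

abbreviation "T \<equiv> tensor K B H"
abbreviation "TT \<equiv> tensor K T T"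
abbreviation "A \<equiv> biproduct K H B act coact"

sublocale HB: module_pair K H B
  by (intro module_pair.intro H.module alg.module)

sublocale BH: module_pair K B H
  by (intro module_pair.intro H.module alg.module)

sublocale TT: module_pair K T T
  by (intro module_pair.intro BH.module_tensor)

sublocale HR: ring H by (rule H.ring)
sublocale BR: ring B by (rule alg.ring)

lemmas modules = H.module alg.module BH.module_tensor TT.module_tensor

lemma coact_closed [simp]: "b \<in> carrier B \<Longrightarrow> coact b \<in> carrier (tensor K H B)"
  using linear_map_closed[OF coact_linear] .

lemma act_closed [simp]: "h \<in> carrier H \<Longrightarrow> b \<in> carrier B \<Longrightarrow> act h b \<in> carrier B"
  using linear_map_closed[OF act_linear] .

lemma counit_mult:
  "h \<in> carrier H \<Longrightarrow> k \<in> carrier H \<Longrightarrow> counit H (h \<otimes>\<^bsub>H\<^esub> k) = counit H h \<otimes>\<^bsub>K\<^esub> counit H k"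
  using H.counit_algebra_map ring_hom_mult[of "counit H" H "scalars K" h k]
  by (simp add: algebra_map_def scalars_def)

lemma counit_B_smult:
  "a \<in> carrier K \<Longrightarrow> b \<in> carrier B \<Longrightarrow> counit B (a \<odot>\<^bsub>B\<^esub> b) = a \<otimes>\<^bsub>K\<^esub> counit B b"
  using linear_map_smult[OF coalg.counit_linear, of a b] by (simp add: scalars_def)

lemma counit_B_one: "counit B \<one>\<^bsub>B\<^esub> = \<one>\<^bsub>K\<^esub>"
  using counit_B_algebra_map ring_hom_one[of "counit B" B "scalars K"]
  by (simp add: algebra_map_def scalars_def)

lemma comult_H_one: "comult H \<one>\<^bsub>H\<^esub> = pure_tensor K H H \<one>\<^bsub>H\<^esub> \<one>\<^bsub>H\<^esub>"
  using H.comult_algebra_map ring_hom_one[of "comult H" H "tensor K H H"]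
  by (simp add: algebra_map_def tensor_def)

lemma linear_map_sweedler_coact:
  assumes "module K U" "linear_map K Z B g" "bilinear_map K H B U f"
  shows "linear_map K Z U (\<lambda>z. sweedler U (coact (g z)) f)"
  using linear_map_comp[OF HB.sweedler_linear[OF assms(1,3)]
      linear_map_comp[OF coact_linear assms(2)]] .

text \<open>
  Linearity of a Sweedler expression in one of its variables is derived by following its syntax.
  The search needs no backtracking: of the rules for one operation, only the one for the argument
  that contains the bound variable unifies with the goal.
\<close>

lemmas linear_intros =
  linear_map_id bilinear_mapI
  linear_map_comp[OF H.counit_linear] linear_map_comp[OF coalg.counit_linear]
  linear_map_smult_left[OF H.module] linear_map_smult_left[OF alg.module]
  linear_map_smult_right[OF H.module] linear_map_smult_right[OF alg.module]
  H.linear_map_mult_left H.linear_map_mult_right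
  alg.linear_map_mult_left alg.linear_map_mult_right
  linear_map_act_left[OF left_module_axioms] linear_map_act_right[OF left_module_axioms]
  linear_map_pure_left linear_map_pure_right
  H.linear_map_sweedler_comult coalg.linear_map_sweedler_comult linear_map_sweedler_coact
  H.CC.linear_map_sweedler coalg.CC.linear_map_sweedler HB.linear_map_sweedler
  BH.linear_map_sweedler

lemmas closed = modules BH.pure_closed TT.pure_closed
  H.CC.sweedler_closed coalg.CC.sweedler_closed HB.sweedler_closed BH.sweedler_closed

lemma biproduct_simps [simp]:
  "carrier A = carrier T" "zero A = zero T" "add A = add T" "module.smult A = module.smult T"
  "\<one>\<^bsub>A\<^esub> = pure_tensor K B H \<one>\<^bsub>B\<^esub> \<one>\<^bsub>H\<^esub>"
  by (simp_all add: biproduct_def Let_def)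

lemma linear_map_biproduct_iff [simp]:
  "linear_map K A U f \<longleftrightarrow> linear_map K T U f" "linear_map K U A g \<longleftrightarrow> linear_map K U T g"
  by (simp_all add: linear_map_def)

lemma mult_bilinear:
  "h \<in> carrier H \<Longrightarrow> b \<in> carrier B \<Longrightarrow>
    bilinear_map K B H T (\<lambda>b' h'. sweedler T (comult H h) (\<lambda>h1 h2.
      pure_tensor K B H (b \<otimes>\<^bsub>B\<^esub> act h1 b') (h2 \<otimes>\<^bsub>H\<^esub> h')))"
  by (intro linear_intros) (auto simp: closed)

lemma mult_pure:
  assumes "b \<in> carrier B" "h \<in> carrier H" "b' \<in> carrier B" "h' \<in> carrier H"
  shows "pure_tensor K B H b h \<otimes>\<^bsub>A\<^esub> pure_tensor K B H b' h' =
    sweedler T (comult H h) (\<lambda>h1 h2. pure_tensor K B H (b \<otimes>\<^bsub>B\<^esub> act h1 b') (h2 \<otimes>\<^bsub>H\<^esub> h'))"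
proof -
  let ?P = "pure_tensor K B H"
  let ?f = "\<lambda>b h b' h'. sweedler T (comult H h) (\<lambda>h1 h2. ?P (b \<otimes>\<^bsub>B\<^esub> act h1 b') (h2 \<otimes>\<^bsub>H\<^esub> h'))"
  have "?P b h \<otimes>\<^bsub>A\<^esub> ?P b' h' = sweedler T (?P b h) (\<lambda>b h. sweedler T (?P b' h') (?f b h))"
    by (simp add: biproduct_def Let_def)
  also have "\<dots> = sweedler T (?P b h) (\<lambda>b h. ?f b h b' h')"
    by (intro BH.sweedler_cong BH.sweedler_pure mult_bilinear) (use assms in \<open>auto simp: closed\<close>)
  also have "\<dots> = ?f b h b' h'"
    by (intro BH.sweedler_pure linear_intros) (use assms in \<open>auto simp: closed\<close>)
  finally show ?thesis .
qed

lemma mult_closed: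
  assumes "X \<in> carrier T" "Y \<in> carrier T"
  shows "X \<otimes>\<^bsub>A\<^esub> Y \<in> carrier T"
  unfolding biproduct_def Let_def using assms by (auto simp: closed)

text \<open>
  \<open>B\<close> is the quotient of \<open>A\<close> by the left ideal generated by \<open>1 \<times> h - \<epsilon>(h)(1 \<times> 1)\<close>; the
  following is the induced action of \<open>A\<close>.
\<close>

definition A_act where
  "A_act X c = sweedler B X (\<lambda>b h. b \<otimes>\<^bsub>B\<^esub> act h c)"

lemma A_act_bilinear: "c \<in> carrier B \<Longrightarrow> bilinear_map K B H B (\<lambda>b h. b \<otimes>\<^bsub>B\<^esub> act h c)"
  by (intro linear_intros) auto

lemma A_act_pure:
  "b \<in> carrier B \<Longrightarrow> h \<in> carrier H \<Longrightarrow> c \<in> carrier B \<Longrightarrow>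
    A_act (pure_tensor K B H b h) c = b \<otimes>\<^bsub>B\<^esub> act h c"
  unfolding A_act_def by (intro BH.sweedler_pure alg.module A_act_bilinear)

lemma A_act_linear_left: "c \<in> carrier B \<Longrightarrow> linear_map K T B (\<lambda>X. A_act X c)"
  unfolding A_act_def by (intro BH.sweedler_linear alg.module A_act_bilinear)

lemma A_act_linear: "X \<in> carrier T \<Longrightarrow> linear_map K B B (A_act X)"
  unfolding A_act_def by (intro linear_intros) (auto simp: closed)

text \<open>
  On elements \<open>b \<times> h\<close> and \<open>b' \<times> h'\<close> this is
  \<open>b(h\<^sub>(\<^sub>1\<^sub>) \<cdot> b')(h\<^sub>(\<^sub>2\<^sub>)h' \<cdot> c) = b(h \<cdot> (b'(h' \<cdot> c)))\<close>, the module algebra axiom.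
\<close>

lemma A_act_mult:
  assumes "X \<in> carrier T" "Y \<in> carrier T" "c \<in> carrier B"
  shows "A_act (X \<otimes>\<^bsub>A\<^esub> Y) c = A_act X (A_act Y c)"
proof -
  let ?P = "pure_tensor K B H" and ?D = "comult H"
  note lin = A_act_linear_left[OF assms(3)]
  have "A_act (X \<otimes>\<^bsub>A\<^esub> Y) c = A_act (sweedler T X (\<lambda>b h. sweedler T Y (\<lambda>b' h'. sweedler T (?D h)
      (\<lambda>h1 h2. ?P (b \<otimes>\<^bsub>B\<^esub> act h1 b') (h2 \<otimes>\<^bsub>H\<^esub> h'))))) c"
    by (simp add: biproduct_def Let_def)
  also have "\<dots> = sweedler B X (\<lambda>b h. A_act (sweedler T Y (\<lambda>b' h'. sweedler T (?D h)
      (\<lambda>h1 h2. ?P (b \<otimes>\<^bsub>B\<^esub> act h1 b') (h2 \<otimes>\<^bsub>H\<^esub> h')))) c)"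
    by (intro BH.linear_sweedler[OF BH.module_tensor alg.module lin]) (auto simp: closed assms)
  also have "\<dots> = sweedler B X (\<lambda>b h. sweedler B Y (\<lambda>b' h'. A_act (sweedler T (?D h)
      (\<lambda>h1 h2. ?P (b \<otimes>\<^bsub>B\<^esub> act h1 b') (h2 \<otimes>\<^bsub>H\<^esub> h'))) c))"
    by (intro BH.sweedler_cong BH.linear_sweedler[OF BH.module_tensor alg.module lin])
      (auto simp: closed assms)
  also have "\<dots> = sweedler B X (\<lambda>b h. sweedler B Y (\<lambda>b' h'. b \<otimes>\<^bsub>B\<^esub> act h (b' \<otimes>\<^bsub>B\<^esub> act h' c)))"
  proof (intro BH.sweedler_cong)
    fix b h b' h'
    assume *: "b \<in> carrier B" "h \<in> carrier H" "b' \<in> carrier B" "h' \<in> carrier H"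
    have "A_act (sweedler T (?D h) (\<lambda>h1 h2. ?P (b \<otimes>\<^bsub>B\<^esub> act h1 b') (h2 \<otimes>\<^bsub>H\<^esub> h'))) c =
      sweedler B (?D h) (\<lambda>h1 h2. A_act (?P (b \<otimes>\<^bsub>B\<^esub> act h1 b') (h2 \<otimes>\<^bsub>H\<^esub> h')) c)"
      by (intro H.CC.linear_sweedler[OF BH.module_tensor alg.module lin]) (auto simp: closed assms *)
    also have "\<dots> = sweedler B (?D h) (\<lambda>h1 h2. b \<otimes>\<^bsub>B\<^esub> (act h1 b' \<otimes>\<^bsub>B\<^esub> act h2 (act h' c)))"
      by (intro H.CC.sweedler_cong) (auto simp: A_act_pure assms * act_mult BR.m_assoc)
    also have "\<dots> = b \<otimes>\<^bsub>B\<^esub> sweedler B (?D h) (\<lambda>h1 h2. act h1 b' \<otimes>\<^bsub>B\<^esub> act h2 (act h' c))"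
      by (intro H.CC.linear_sweedler[OF alg.module alg.module, symmetric] linear_intros)
        (auto simp: closed assms *)
    finally show "A_act (sweedler T (?D h) (\<lambda>h1 h2. ?P (b \<otimes>\<^bsub>B\<^esub> act h1 b') (h2 \<otimes>\<^bsub>H\<^esub> h'))) c =
        b \<otimes>\<^bsub>B\<^esub> act h (b' \<otimes>\<^bsub>B\<^esub> act h' c)"
      using * assms by (simp add: module_algebra_mult)
  qed (use assms in auto)
  also have "\<dots> = sweedler B X (\<lambda>b h. b \<otimes>\<^bsub>B\<^esub> act h (A_act Y c))"
    unfolding A_act_def
    by (intro BH.sweedler_cong BH.linear_sweedler[OF alg.module alg.module, symmetric]
        linear_intros) (auto simp: closed assms)
  finally show ?thesis by (simp add: A_act_def)
qed

lemma A_act_module: "left_module K A B A_act"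
  by unfold_locales
    (auto simp: A_act_linear A_act_linear_left A_act_mult A_act_pure act_one)

lemma proj_B_bilinear: "bilinear_map K B H B (\<lambda>b h. counit H h \<odot>\<^bsub>B\<^esub> b)"
  by (intro linear_intros) (auto simp: closed)

lemma proj_H_bilinear: "bilinear_map K B H H (\<lambda>b h. counit B b \<odot>\<^bsub>H\<^esub> h)"
  by (intro linear_intros) (auto simp: closed)

lemma proj_B_linear: "linear_map K T B (proj_B H B)"
  unfolding proj_B_def by (intro BH.sweedler_linear alg.module proj_B_bilinear)

lemma proj_H_linear: "linear_map K T H (proj_H H B)"
  unfolding proj_H_def by (intro BH.sweedler_linear H.module proj_H_bilinear)

lemma proj_B_pure:
  "b \<in> carrier B \<Longrightarrow> h \<in> carrier H \<Longrightarrow>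
    proj_B H B (pure_tensor K B H b h) = counit H h \<odot>\<^bsub>B\<^esub> b"
  unfolding proj_B_def by (intro BH.sweedler_pure alg.module proj_B_bilinear)

lemma proj_H_pure:
  "b \<in> carrier B \<Longrightarrow> h \<in> carrier H \<Longrightarrow>
    proj_H H B (pure_tensor K B H b h) = counit B b \<odot>\<^bsub>H\<^esub> h"
  unfolding proj_H_def by (intro BH.sweedler_pure H.module proj_H_bilinear)

lemma A_act_one:
  assumes "X \<in> carrier T"
  shows "A_act X \<one>\<^bsub>B\<^esub> = proj_B H B X"
  unfolding A_act_def proj_B_def
  by (intro BH.sweedler_cong assms) (simp add: module_algebra_one alg.mult_smult)

text \<open>
  Since \<open>\<Pi>(X) = X \<rhd> 1\<close>, the projection is \<open>A\<close>-linear although it is not multiplicative.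
\<close>

lemma proj_B_mult:
  assumes "X \<in> carrier T" "Y \<in> carrier T"
  shows "proj_B H B (X \<otimes>\<^bsub>A\<^esub> Y) = A_act X (proj_B H B Y)"
  using A_act_mult[OF assms BR.one_closed] by (simp add: A_act_one mult_closed assms)

lemma incl_H_algebra_map: "algebra_map K H A (incl_H K H B)"
  unfolding algebra_map_def incl_H_def
proof (intro conjI ring_hom_memI)
  show lin: "linear_map K H A (pure_tensor K B H \<one>\<^bsub>B\<^esub>)"
    unfolding linear_map_biproduct_iff by (intro linear_intros modules) auto
  fix h k assume *: "h \<in> carrier H" "k \<in> carrier H"
  show "pure_tensor K B H \<one>\<^bsub>B\<^esub> (h \<oplus>\<^bsub>H\<^esub> k) =
      pure_tensor K B H \<one>\<^bsub>B\<^esub> h \<oplus>\<^bsub>A\<^esub> pure_tensor K B H \<one>\<^bsub>B\<^esub> k"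
    using linear_map_add[OF lin *] .
  have "pure_tensor K B H \<one>\<^bsub>B\<^esub> h \<otimes>\<^bsub>A\<^esub> pure_tensor K B H \<one>\<^bsub>B\<^esub> k =
      sweedler T (comult H h) (\<lambda>h1 h2. pure_tensor K B H (\<one>\<^bsub>B\<^esub> \<otimes>\<^bsub>B\<^esub> act h1 \<one>\<^bsub>B\<^esub>) (h2 \<otimes>\<^bsub>H\<^esub> k))"
    using * by (intro mult_pure) auto
  also have "\<dots> = sweedler T (comult H h) (\<lambda>h1 h2.
      pure_tensor K B H \<one>\<^bsub>B\<^esub> ((counit H h1 \<odot>\<^bsub>H\<^esub> h2) \<otimes>\<^bsub>H\<^esub> k))"
    using * by (intro H.CC.sweedler_cong)
      (auto simp: module_algebra_one BH.pure_smult H.smult_mult)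
  also have "\<dots> = pure_tensor K B H \<one>\<^bsub>B\<^esub>
      (sweedler H (comult H h) (\<lambda>h1 h2. counit H h1 \<odot>\<^bsub>H\<^esub> h2) \<otimes>\<^bsub>H\<^esub> k)"
    using * by (intro H.CC.linear_sweedler[symmetric, OF H.module BH.module_tensor] linear_intros)
      (auto simp: closed)
  finally show "pure_tensor K B H \<one>\<^bsub>B\<^esub> (h \<otimes>\<^bsub>H\<^esub> k) =
      pure_tensor K B H \<one>\<^bsub>B\<^esub> h \<otimes>\<^bsub>A\<^esub> pure_tensor K B H \<one>\<^bsub>B\<^esub> k"
    using * by (simp add: H.counit_left)
qed (auto simp: closed)

section \<open>The coproduct of the biproduct\<close>

lemma comult_bilinear:
  "bilinear_map K B H TT (\<lambda>b h. sweedler TT (comult B b) (\<lambda>b1 b2. sweedler TT (coact b2) (\<lambda>x b20.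
    sweedler TT (comult H h) (\<lambda>h1 h2.
      pure_tensor K T T (pure_tensor K B H b1 (x \<otimes>\<^bsub>H\<^esub> h1)) (pure_tensor K B H b20 h2)))))"
  by (intro linear_intros) (auto simp: closed)

lemma comult_biproduct:
  "comult A X = sweedler TT X (\<lambda>b h. sweedler TT (comult B b) (\<lambda>b1 b2. sweedler TT (coact b2)
    (\<lambda>x b20. sweedler TT (comult H h) (\<lambda>h1 h2.
      pure_tensor K T T (pure_tensor K B H b1 (x \<otimes>\<^bsub>H\<^esub> h1)) (pure_tensor K B H b20 h2)))))"
  by (simp add: biproduct_def Let_def)

lemma comult_linear: "linear_map K T TT (comult A)"
  unfolding comult_biproduct
  by (intro BH.sweedler_linear TT.module_tensor comult_bilinear)

text \<open>
  Linear maps out of \<open>A \<otimes> A\<close> are pulled through the three nested sums of the coproduct.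
\<close>

lemma linear_comult_pure:
  assumes L: "module K U" "linear_map K TT U L" and b: "b \<in> carrier B" and h: "h \<in> carrier H"
  shows "L (comult A (pure_tensor K B H b h)) =
    sweedler U (comult B b) (\<lambda>b1 b2. sweedler U (coact b2) (\<lambda>x b20.
      sweedler U (comult H h) (\<lambda>h1 h2.
        L (pure_tensor K T T (pure_tensor K B H b1 (x \<otimes>\<^bsub>H\<^esub> h1)) (pure_tensor K B H b20 h2)))))"
proof -
  let ?p = "\<lambda>b1 x b20 h1 h2.
    pure_tensor K T T (pure_tensor K B H b1 (x \<otimes>\<^bsub>H\<^esub> h1)) (pure_tensor K B H b20 h2)"
  note push = TT.module_tensor L
  have "comult A (pure_tensor K B H b h) = sweedler TT (comult B b) (\<lambda>b1 b2.
      sweedler TT (coact b2) (\<lambda>x b20. sweedler TT (comult H h) (\<lambda>h1 h2. ?p b1 x b20 h1 h2)))"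
    unfolding comult_biproduct by (rule BH.sweedler_pure[OF TT.module_tensor comult_bilinear b h])
  then have "L (comult A (pure_tensor K B H b h)) = L (sweedler TT (comult B b) (\<lambda>b1 b2.
      sweedler TT (coact b2) (\<lambda>x b20. sweedler TT (comult H h) (\<lambda>h1 h2. ?p b1 x b20 h1 h2))))"
    by simp
  also have "\<dots> = sweedler U (comult B b) (\<lambda>b1 b2. L (sweedler TT (coact b2) (\<lambda>x b20.
      sweedler TT (comult H h) (\<lambda>h1 h2. ?p b1 x b20 h1 h2))))"
    by (intro coalg.CC.linear_sweedler[OF push]) (auto simp: closed b h)
  also have "\<dots> = sweedler U (comult B b) (\<lambda>b1 b2. sweedler U (coact b2) (\<lambda>x b20.
      L (sweedler TT (comult H h) (\<lambda>h1 h2. ?p b1 x b20 h1 h2))))"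
    by (intro coalg.CC.sweedler_cong HB.linear_sweedler[OF push]) (auto simp: closed b h)
  also have "\<dots> = sweedler U (comult B b) (\<lambda>b1 b2. sweedler U (coact b2) (\<lambda>x b20.
      sweedler U (comult H h) (\<lambda>h1 h2. L (?p b1 x b20 h1 h2))))"
    by (intro coalg.CC.sweedler_cong HB.sweedler_cong H.CC.linear_sweedler[OF push])
      (auto simp: closed b h)
  finally show ?thesis .
qed

lemma proj_pure_bilinear:
  assumes "linear_map K T B G" "linear_map K T H P"
  shows "bilinear_map K T T T (\<lambda>x y. pure_tensor K B H (G x) (P y))"
  by (intro linear_intros modules assms linear_map_closed[OF assms(1)] linear_map_closed[OF assms(2)])

text \<open>
  Used with \<open>G = \<Pi>\<close> for the decomposition of elements of \<open>A\<close> and with \<open>G = \<Pi> \<circ> F\<close> for the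
  description of \<open>F\<close>.
\<close>

lemma sweedler_biproduct_comult:
  assumes G: "linear_map K T B G" and b: "b \<in> carrier B" and h: "h \<in> carrier H"
  shows "sweedler T (comult A (pure_tensor K B H b h))
      (\<lambda>x y. pure_tensor K B H (G x) (proj_H H B y)) =
    sweedler T (comult B b) (\<lambda>b1 b2. sweedler T (coact b2) (\<lambda>x b20. sweedler T (comult H h) (\<lambda>h1 h2.
      pure_tensor K B H (G (pure_tensor K B H b1 (x \<otimes>\<^bsub>H\<^esub> h1))) (counit B b20 \<odot>\<^bsub>H\<^esub> h2))))"
proof -
  note bil = proj_pure_bilinear[OF G proj_H_linear]
  show ?thesis
    unfolding linear_comult_pure[OF BH.module_tensor TT.sweedler_linear[OF BH.module_tensor bil] b h]
    by (intro coalg.CC.sweedler_cong HB.sweedler_cong H.CC.sweedler_cong)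
      (auto simp: closed b h TT.sweedler_pure[OF BH.module_tensor bil] proj_H_pure)
qed

text \<open>
  \<open>X = \<Pi>(X\<^sub>(\<^sub>1\<^sub>)) \<times> \<pi>(X\<^sub>(\<^sub>2\<^sub>))\<close>: on \<open>b \<times> h\<close> the counits contract, in turn, the coproduct of
  \<open>h\<close>, the coaction on \<open>b\<^sub>(\<^sub>2\<^sub>)\<close> and the coproduct of \<open>b\<close>.
\<close>

lemma biproduct_decomposition:
  assumes "X \<in> carrier T"
  shows "sweedler T (comult A X) (\<lambda>x y. pure_tensor K B H (proj_B H B x) (proj_H H B y)) = X"
proof (rule BH.linear_map_eqI[OF BH.module_tensor _ linear_map_id assms])
  let ?P = "pure_tensor K B H"
  note bil = proj_pure_bilinear[OF proj_B_linear proj_H_linear]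
  show "linear_map K T T (\<lambda>X. sweedler T (comult A X) (\<lambda>x y. ?P (proj_B H B x) (proj_H H B y)))"
    by (rule linear_map_comp[OF TT.sweedler_linear[OF BH.module_tensor bil] comult_linear])
  fix b h assume b: "b \<in> carrier B" and h: "h \<in> carrier H"
  have "sweedler T (comult A (?P b h)) (\<lambda>x y. ?P (proj_B H B x) (proj_H H B y)) =
      sweedler T (comult B b) (\<lambda>b1 b2. sweedler T (coact b2) (\<lambda>x b20. sweedler T (comult H h)
        (\<lambda>h1 h2. ?P (counit H (x \<otimes>\<^bsub>H\<^esub> h1) \<odot>\<^bsub>B\<^esub> b1) (counit B b20 \<odot>\<^bsub>H\<^esub> h2))))"
    unfolding sweedler_biproduct_comult[OF proj_B_linear b h]
    by (intro coalg.CC.sweedler_cong HB.sweedler_cong H.CC.sweedler_cong)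
      (auto simp: closed b h proj_B_pure)
  also have "\<dots> = sweedler T (comult B b) (\<lambda>b1 b2. sweedler T (coact b2) (\<lambda>x b20.
      ?P b1 (counit B (counit H x \<odot>\<^bsub>B\<^esub> b20) \<odot>\<^bsub>H\<^esub> h)))"
  proof (intro coalg.CC.sweedler_cong HB.sweedler_cong)
    fix b1 b2 x b20
    assume *: "b1 \<in> carrier B" "b2 \<in> carrier B" "x \<in> carrier H" "b20 \<in> carrier B"
    have "sweedler T (comult H h)
        (\<lambda>h1 h2. ?P (counit H (x \<otimes>\<^bsub>H\<^esub> h1) \<odot>\<^bsub>B\<^esub> b1) (counit B b20 \<odot>\<^bsub>H\<^esub> h2)) =
      sweedler T (comult H h)
        (\<lambda>h1 h2. ?P b1 ((counit H x \<otimes>\<^bsub>K\<^esub> counit B b20) \<odot>\<^bsub>H\<^esub> (counit H h1 \<odot>\<^bsub>H\<^esub> h2)))"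
      using * h by (intro H.CC.sweedler_cong)
        (auto simp: counit_mult BH.pure_smult H.CC.V.R.m_assoc H.CC.V.R.m_comm H.CC.V.R.m_lcomm
          simp flip: H.CC.V.smult_assoc1)
    also have "\<dots> = ?P b1 ((counit H x \<otimes>\<^bsub>K\<^esub> counit B b20) \<odot>\<^bsub>H\<^esub>
        sweedler H (comult H h) (\<lambda>h1 h2. counit H h1 \<odot>\<^bsub>H\<^esub> h2))"
      using * h by (intro H.CC.linear_sweedler[symmetric, OF H.module BH.module_tensor] linear_intros)
        (auto simp: closed)
    also have "\<dots> = ?P b1 (counit B (counit H x \<odot>\<^bsub>B\<^esub> b20) \<odot>\<^bsub>H\<^esub> h)"
      using * h by (simp add: H.counit_left counit_B_smult)
    finally show "sweedler T (comult H h)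
        (\<lambda>h1 h2. ?P (counit H (x \<otimes>\<^bsub>H\<^esub> h1) \<odot>\<^bsub>B\<^esub> b1) (counit B b20 \<odot>\<^bsub>H\<^esub> h2)) = \<dots>" .
  qed (use b in auto)
  also have "\<dots> = sweedler T (comult B b) (\<lambda>b1 b2.
      ?P b1 (counit B (sweedler B (coact b2) (\<lambda>x b20. counit H x \<odot>\<^bsub>B\<^esub> b20)) \<odot>\<^bsub>H\<^esub> h))"
    using b h by (intro coalg.CC.sweedler_cong
        HB.linear_sweedler[symmetric, OF alg.module BH.module_tensor] linear_intros)
      (auto simp: closed)
  also have "\<dots> = sweedler T (comult B b) (\<lambda>b1 b2. ?P (counit B b2 \<odot>\<^bsub>B\<^esub> b1) h)"
    using b h by (intro coalg.CC.sweedler_cong) (auto simp: coact_counit BH.pure_smult)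
  also have "\<dots> = ?P (sweedler B (comult B b) (\<lambda>b1 b2. counit B b2 \<odot>\<^bsub>B\<^esub> b1)) h"
    using b h by (intro coalg.CC.linear_sweedler[symmetric, OF alg.module BH.module_tensor]
        linear_intros) (auto simp: closed)
  finally show "sweedler T (comult A (?P b h)) (\<lambda>x y. ?P (proj_B H B x) (proj_H H B y)) = ?P b h"
    using b by (simp add: coalg.counit_right)
qed

lemma tensor_biproduct:
  "pure_tensor K A A = pure_tensor K T T" "sweedler (tensor K A A) X f = sweedler TT X f"
proof -
  have "tensor_eq K A A xs ys \<longleftrightarrow> tensor_eq K T T xs ys" for xs ys
    by (intro iffI; erule tensor_eq_transfer[rotated 8]) simp_all
  then have cls: "tensor_class K A A = tensor_class K T T"
    by (simp add: tensor_class_def fun_eq_iff)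
  then show "pure_tensor K A A = pure_tensor K T T"
    by (simp add: pure_tensor_def fun_eq_iff)
  have "zero (tensor K A A) = zero TT" "add (tensor K A A) = add TT"
    by (simp_all add: tensor_def[of K A A] tensor_def[of K T T] cls)
  then show "sweedler (tensor K A A) X f = sweedler TT X f"
    by (simp add: sweedler_def)
qed

end

section \<open>Endomorphisms over the projection\<close>

locale biproduct_endomorphism = biproduct_datum K H B act coact
  for K :: "('k, 'l) ring_scheme" and H :: "('k, 'h, 'm) hopf_scheme"
    and B :: "('k, 'b, 'n) hopf_scheme"
    and act :: "'h \<Rightarrow> 'b \<Rightarrow> 'b" and coact :: "'b \<Rightarrow> ('h \<times> 'b) list set" +
  fixes F :: "('b \<times> 'h) list set \<Rightarrow> ('b \<times> 'h) list set"
  assumes End: "F \<in> End_Hopf K A (proj_H H B)"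
begin

abbreviation "F\<^sub>L \<equiv> left_part K H B F"
abbreviation "F\<^sub>R \<equiv> right_part K H B F"

lemma F_algebra_map: "algebra_map K A A F"
  and F_ring_hom: "F \<in> ring_hom A A"
  and F_linear: "linear_map K T T F"
  using End by (auto simp: End_Hopf_def hopf_map_def algebra_map_def)

lemma F_closed [simp]: "X \<in> carrier T \<Longrightarrow> F X \<in> carrier T"
  using linear_map_closed[OF F_linear] .

lemma F_comult:
  assumes "X \<in> carrier T"
  shows "comult A (F X) = sweedler TT (comult A X) (\<lambda>x y. pure_tensor K T T (F x) (F y))"
  using End assms
  by (simp add: End_Hopf_def hopf_map_def coalgebra_map_def tensor_biproduct)

lemma proj_H_F: "X \<in> carrier T \<Longrightarrow> proj_H H B (F X) = proj_H H B X"
  using End by (simp add: End_Hopf_def)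

lemma projF_linear: "linear_map K T B (\<lambda>X. proj_B H B (F X))"
  by (rule linear_map_comp[OF proj_B_linear F_linear])

text \<open>
  \<open>F(X) = \<Pi>(F(X\<^sub>(\<^sub>1\<^sub>))) \<times> \<pi>(X\<^sub>(\<^sub>2\<^sub>))\<close>: decompose \<open>F(X)\<close>, move \<open>F\<close> inside because it is
  a coalgebra map, and drop it under \<open>\<pi>\<close>.  Thus \<open>\<Pi> \<circ> F\<close> determines \<open>F\<close>.
\<close>

lemma F_expand:
  assumes X: "X \<in> carrier T"
  shows "F X = sweedler T (comult A X)
    (\<lambda>x y. pure_tensor K B H (proj_B H B (F x)) (proj_H H B y))"
proof -
  let ?P = "pure_tensor K B H"
  note bil = proj_pure_bilinear[OF proj_B_linear proj_H_linear]
  note lin = TT.sweedler_linear[OF BH.module_tensor bil]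
  have X': "comult A X \<in> carrier TT" by (rule linear_map_closed[OF comult_linear X])
  have "F X = sweedler T (sweedler TT (comult A X) (\<lambda>x y. pure_tensor K T T (F x) (F y)))
      (\<lambda>x y. ?P (proj_B H B x) (proj_H H B y))"
    using biproduct_decomposition[of "F X"] X by (simp add: F_comult)
  also have "\<dots> = sweedler T (comult A X) (\<lambda>x y. sweedler T (pure_tensor K T T (F x) (F y))
      (\<lambda>x y. ?P (proj_B H B x) (proj_H H B y)))"
    by (intro TT.linear_sweedler[OF TT.module_tensor BH.module_tensor lin] X' TT.pure_closed F_closed)
  also have "\<dots> = sweedler T (comult A X) (\<lambda>x y. ?P (proj_B H B (F x)) (proj_H H B y))"
    by (intro TT.sweedler_cong X')
      (simp add: TT.sweedler_pure[OF BH.module_tensor bil] proj_H_F)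
  finally show ?thesis .
qed

lemma F_pure:
  assumes b: "b \<in> carrier B" and h: "h \<in> carrier H"
  shows "F (pure_tensor K B H b h) =
    sweedler T (comult B b) (\<lambda>b1 b2. sweedler T (coact b2) (\<lambda>x b20. sweedler T (comult H h) (\<lambda>h1 h2.
      pure_tensor K B H (proj_B H B (F (pure_tensor K B H b1 (x \<otimes>\<^bsub>H\<^esub> h1))))
        (counit B b20 \<odot>\<^bsub>H\<^esub> h2))))"
  using sweedler_biproduct_comult[OF projF_linear b h] F_expand[OF BH.pure_closed[OF b h]] by simp

lemmas projF_intros = linear_intros linear_map_comp[OF projF_linear]

lemma projF_closed [simp]: "X \<in> carrier T \<Longrightarrow> proj_B H B (F X) \<in> carrier B"
  using linear_map_closed[OF projF_linear] .

lemma F_incl_H: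
  assumes h: "h \<in> carrier H"
  shows "F (incl_H K H B h) = sweedler T (comult H h) (\<lambda>h1 h2. pure_tensor K B H (F\<^sub>R h1) h2)"
proof -
  let ?P = "pure_tensor K B H" and ?I = "\<one>\<^bsub>B\<^esub>"
  let ?f = "\<lambda>b1 x b20 h1 h2. ?P (proj_B H B (F (?P b1 (x \<otimes>\<^bsub>H\<^esub> h1)))) (counit B b20 \<odot>\<^bsub>H\<^esub> h2)"
  have "F (?P ?I h) = sweedler T (pure_tensor K B B ?I ?I)
      (\<lambda>b1 b2. sweedler T (coact b2) (\<lambda>x b20. sweedler T (comult H h) (?f b1 x b20)))"
    using F_pure[OF BR.one_closed h] by (simp add: comult_B_one)
  also have "\<dots> = sweedler T (coact ?I) (\<lambda>x b20. sweedler T (comult H h) (?f ?I x b20))"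
    by (intro coalg.CC.sweedler_pure projF_intros) (auto simp: closed h)
  also have "\<dots> = sweedler T (comult H h) (?f ?I \<one>\<^bsub>H\<^esub> ?I)"
    unfolding comodule_algebra_one
    by (intro HB.sweedler_pure projF_intros) (auto simp: closed h)
  also have "\<dots> = sweedler T (comult H h) (\<lambda>h1 h2. ?P (F\<^sub>R h1) h2)"
    by (intro H.CC.sweedler_cong) (auto simp: h right_part_def incl_H_def counit_B_one)
  finally show ?thesis by (simp add: incl_H_def)
qed

text \<open>
  The \<open>H\<close>-component is trivial because the coaction is compatible with the counit of \<open>B\<close>:
  \<open>\<Pi>(F(b\<^sub>(\<^sub>1\<^sub>) \<times> b\<^sub>(\<^sub>2\<^sub>)\<^sub>(\<^sub>-\<^sub>1\<^sub>))) \<times> \<epsilon>(b\<^sub>(\<^sub>2\<^sub>)\<^sub>(\<^sub>0\<^sub>))1\<close> contracts to \<open>\<Pi>(F(b \<times> 1)) \<times> 1\<close>.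
\<close>

lemma F_incl_B:
  assumes b: "b \<in> carrier B"
  shows "F (incl_B K H B b) = incl_B K H B (F\<^sub>L b)"
proof -
  let ?P = "pure_tensor K B H" and ?I = "\<one>\<^bsub>H\<^esub>"
  let ?g = "\<lambda>b x. ?P (proj_B H B (F (?P b x))) ?I"
  let ?f = "\<lambda>b1 x b20 h1 h2. ?P (proj_B H B (F (?P b1 (x \<otimes>\<^bsub>H\<^esub> h1)))) (counit B b20 \<odot>\<^bsub>H\<^esub> h2)"
  have g_right: "linear_map K H T (?g b1)" if "b1 \<in> carrier B" for b1
    using that by (intro projF_intros) (auto simp: closed)
  have g_left: "linear_map K B T (\<lambda>b1. ?g b1 ?I)"
    by (intro projF_intros) (auto simp: closed)
  have "F (?P b ?I) = sweedler T (comult B b) (\<lambda>b1 b2. sweedler T (coact b2) (\<lambda>x b20.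
      sweedler T (pure_tensor K H H ?I ?I) (?f b1 x b20)))"
    using F_pure[OF b HR.one_closed] by (simp add: comult_H_one)
  also have "\<dots> = sweedler T (comult B b) (\<lambda>b1 b2. sweedler T (coact b2) (\<lambda>x b20. ?f b1 x b20 ?I ?I))"
    by (intro coalg.CC.sweedler_cong HB.sweedler_cong H.CC.sweedler_pure projF_intros)
      (auto simp: closed b)
  also have "\<dots> = sweedler T (comult B b) (\<lambda>b1 b2. sweedler T (coact b2)
      (\<lambda>x b20. ?g b1 (counit B b20 \<odot>\<^bsub>H\<^esub> x)))"
  proof (intro coalg.CC.sweedler_cong HB.sweedler_cong)
    \<comment> \<open>The scalar moves from the right tensor factor into the argument of \<open>F\<close>, next to
      \<open>x\<close>, where the counit axiom of the coaction applies.\<close>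
    fix b1 b2 x b20
    assume *: "b1 \<in> carrier B" "b2 \<in> carrier B" "x \<in> carrier H" "b20 \<in> carrier B"
    have "?g b1 (counit B b20 \<odot>\<^bsub>H\<^esub> x) = counit B b20 \<odot>\<^bsub>T\<^esub> ?g b1 x"
      using * by (intro linear_map_smult[OF g_right]) auto
    also have "\<dots> = ?P (proj_B H B (F (?P b1 x))) (counit B b20 \<odot>\<^bsub>H\<^esub> ?I)"
      using * by (intro linear_map_smult[OF bilinear_map_right[OF BH.pure_bilinear], symmetric])
        (auto simp: closed)
    finally show "?f b1 x b20 ?I ?I = ?g b1 (counit B b20 \<odot>\<^bsub>H\<^esub> x)" using * by simp
  qed (auto simp: b)
  also have "\<dots> = sweedler T (comult B b) (\<lambda>b1 b2.
      ?g b1 (sweedler H (coact b2) (\<lambda>x b20. counit B b20 \<odot>\<^bsub>H\<^esub> x)))"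
    by (intro coalg.CC.sweedler_cong
        HB.linear_sweedler[OF H.module BH.module_tensor g_right, symmetric]) (auto simp: closed b)
  also have "\<dots> = sweedler T (comult B b) (\<lambda>b1 b2. ?g (counit B b2 \<odot>\<^bsub>B\<^esub> b1) ?I)"
    by (intro coalg.CC.sweedler_cong)
      (auto simp: comodule_coalgebra_counit BH.pure_smult b)
  also have "\<dots> = ?g (sweedler B (comult B b) (\<lambda>b1 b2. counit B b2 \<odot>\<^bsub>B\<^esub> b1)) ?I"
    by (intro coalg.CC.linear_sweedler[OF alg.module BH.module_tensor g_left, symmetric])
      (auto simp: b)
  also have "\<dots> = ?g b ?I" using b by (simp add: coalg.counit_right)
  finally show ?thesis by (simp add: incl_B_def left_part_def)
qed

lemma F\<^sub>L_linear: "linear_map K B B F\<^sub>L"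
  unfolding left_part_def incl_B_def comp_def by (intro projF_intros) (auto simp: closed)

lemma F\<^sub>R_linear: "linear_map K H B F\<^sub>R"
  unfolding right_part_def incl_H_def comp_def by (intro projF_intros) (auto simp: closed)

lemma parts_closed [simp]:
  "b \<in> carrier B \<Longrightarrow> F\<^sub>L b \<in> carrier B" "h \<in> carrier H \<Longrightarrow> F\<^sub>R h \<in> carrier B"
  using linear_map_closed[OF F\<^sub>L_linear] linear_map_closed[OF F\<^sub>R_linear] by auto

lemmas parts_intros = linear_intros linear_map_comp[OF F\<^sub>L_linear] linear_map_comp[OF F\<^sub>R_linear]

lemma incl_H_closed [simp]: "h \<in> carrier H \<Longrightarrow> incl_H K H B h \<in> carrier T"
  and incl_B_closed [simp]: "b \<in> carrier B \<Longrightarrow> incl_B K H B b \<in> carrier T"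
  by (simp_all add: incl_H_def incl_B_def closed)

lemma F_incl_H_module: "left_module K H B (\<lambda>h. A_act (F (incl_H K H B h)))"
  by (rule left_module_pullback[OF left_module_pullback[OF A_act_module F_algebra_map]
        incl_H_algebra_map])

lemma A_act_F_incl_H:
  assumes h: "h \<in> carrier H" and c: "c \<in> carrier B"
  shows "A_act (F (incl_H K H B h)) c = sweedler B (comult H h) (\<lambda>h1 h2. F\<^sub>R h1 \<otimes>\<^bsub>B\<^esub> act h2 c)"
proof -
  have "A_act (F (incl_H K H B h)) c =
      sweedler B (comult H h) (\<lambda>h1 h2. A_act (pure_tensor K B H (F\<^sub>R h1) h2) c)"
    unfolding F_incl_H[OF h]
    by (intro H.CC.linear_sweedler[OF BH.module_tensor alg.module A_act_linear_left])
      (auto simp: closed h c)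
  also have "\<dots> = sweedler B (comult H h) (\<lambda>h1 h2. F\<^sub>R h1 \<otimes>\<^bsub>B\<^esub> act h2 c)"
    by (intro H.CC.sweedler_cong) (auto simp: A_act_pure h c)
  finally show ?thesis .
qed

lemma incl_B_mult_incl_H:
  assumes "b \<in> carrier B" "h \<in> carrier H"
  shows "incl_B K H B b \<otimes>\<^bsub>A\<^esub> incl_H K H B h = pure_tensor K B H b h"
proof -
  have "incl_B K H B b \<otimes>\<^bsub>A\<^esub> incl_H K H B h = sweedler T (pure_tensor K H H \<one>\<^bsub>H\<^esub> \<one>\<^bsub>H\<^esub>)
      (\<lambda>h1 h2. pure_tensor K B H (b \<otimes>\<^bsub>B\<^esub> act h1 \<one>\<^bsub>B\<^esub>) (h2 \<otimes>\<^bsub>H\<^esub> h))"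
    unfolding incl_B_def incl_H_def comult_H_one[symmetric] using assms by (intro mult_pure) auto
  also have "\<dots> = pure_tensor K B H (b \<otimes>\<^bsub>B\<^esub> act \<one>\<^bsub>H\<^esub> \<one>\<^bsub>B\<^esub>) (\<one>\<^bsub>H\<^esub> \<otimes>\<^bsub>H\<^esub> h)"
    by (intro H.CC.sweedler_pure linear_intros) (auto simp: closed assms)
  finally show ?thesis using assms by (simp add: act_one)
qed

lemma incl_H_mult_incl_B:
  assumes "h \<in> carrier H" "b \<in> carrier B"
  shows "incl_H K H B h \<otimes>\<^bsub>A\<^esub> incl_B K H B b =
    sweedler T (comult H h) (\<lambda>h1 h2. pure_tensor K B H (act h1 b) h2)"
  unfolding incl_B_def incl_H_def
  by (subst mult_pure) (auto simp: assms intro!: H.CC.sweedler_cong)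

text \<open>
  The two ways of evaluating \<open>\<Pi> \<circ> F\<close> at \<open>(1 \<times> h)(b \<times> 1) = h\<^sub>(\<^sub>1\<^sub>) \<cdot> b \<times> h\<^sub>(\<^sub>2\<^sub>)\<close>: directly as a
  product, and after factoring every summand as \<open>(h\<^sub>(\<^sub>1\<^sub>) \<cdot> b \<times> 1)(1 \<times> h\<^sub>(\<^sub>2\<^sub>))\<close>.
\<close>

lemma twisted_linearity:
  assumes h: "h \<in> carrier H" and b: "b \<in> carrier B"
  shows "sweedler B (comult H h) (\<lambda>h1 h2. F\<^sub>R h1 \<otimes>\<^bsub>B\<^esub> act h2 (F\<^sub>L b)) =
    sweedler B (comult H h) (\<lambda>h1 h2. F\<^sub>L (act h1 b) \<otimes>\<^bsub>B\<^esub> F\<^sub>R h2)"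
proof -
  let ?j = "incl_H K H B" and ?J = "incl_B K H B" and ?\<Pi> = "proj_B H B"
  have "sweedler B (comult H h) (\<lambda>h1 h2. F\<^sub>R h1 \<otimes>\<^bsub>B\<^esub> act h2 (F\<^sub>L b)) =
      A_act (F (?j h)) (?\<Pi> (F (?J b)))"
    using h b by (simp add: A_act_F_incl_H left_part_def)
  also have "\<dots> = ?\<Pi> (F (?j h \<otimes>\<^bsub>A\<^esub> ?J b))"
    using h b by (simp add: proj_B_mult ring_hom_mult[OF F_ring_hom])
  also have "\<dots> = sweedler B (comult H h) (\<lambda>h1 h2. ?\<Pi> (F (pure_tensor K B H (act h1 b) h2)))"
    unfolding incl_H_mult_incl_B[OF h b]
    by (intro H.CC.linear_sweedler[OF BH.module_tensor alg.module projF_linear])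
      (auto simp: closed h b)
  also have "\<dots> = sweedler B (comult H h) (\<lambda>h1 h2. F\<^sub>L (act h1 b) \<otimes>\<^bsub>B\<^esub> F\<^sub>R h2)"
  proof (intro H.CC.sweedler_cong)
    fix h1 h2 assume *: "h1 \<in> carrier H" "h2 \<in> carrier H"
    let ?c = "act h1 b"
    have c: "?c \<in> carrier B" using * b by simp
    have "?\<Pi> (F (pure_tensor K B H ?c h2)) = A_act (F (?J ?c)) (?\<Pi> (F (?j h2)))"
      using * c by (simp add: proj_B_mult ring_hom_mult[OF F_ring_hom] flip: incl_B_mult_incl_H)
    also have "\<dots> = A_act (?J (F\<^sub>L ?c)) (F\<^sub>R h2)"
      using c by (simp add: F_incl_B right_part_def)
    also have "\<dots> = F\<^sub>L ?c \<otimes>\<^bsub>B\<^esub> F\<^sub>R h2"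
      using * c by (simp add: incl_B_def A_act_pure act_one)
    finally show "?\<Pi> (F (pure_tensor K B H ?c h2)) = F\<^sub>L ?c \<otimes>\<^bsub>B\<^esub> F\<^sub>R h2" .
  qed (simp add: h)
  finally show ?thesis .
qed

text \<open>
  \<open>F\<^sub>R\<close> is left cancellable for convolution, because \<open>F(1 \<times> h) = F\<^sub>R(h\<^sub>(\<^sub>1\<^sub>)) \<times> h\<^sub>(\<^sub>2\<^sub>)\<close> acts on \<open>B\<close>
  as a twist of the given action of \<open>H\<close>.  Put \<open>W(h) = S(h\<^sub>(\<^sub>1\<^sub>)) \<cdot> X(h\<^sub>(\<^sub>2\<^sub>))\<close>.  Then
  \<open>F(1 \<times> h\<^sub>(\<^sub>1\<^sub>)) \<rhd> W(h\<^sub>(\<^sub>2\<^sub>)) = F\<^sub>R(h\<^sub>(\<^sub>1\<^sub>))X(h\<^sub>(\<^sub>2\<^sub>))\<close>.  Both passages, from \<open>X\<close> to \<open>W\<close> and from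
  \<open>W\<close> to the right-hand side, are convolutions with an \<open>H\<close>-action and hence reversible by the antipode.
\<close>

lemma F\<^sub>R_left_cancel:
  assumes X: "linear_map K H B X" and Y: "linear_map K H B Y"
    and eq: "\<And>h. h \<in> carrier H \<Longrightarrow>
      sweedler B (comult H h) (\<lambda>h1 h2. F\<^sub>R h1 \<otimes>\<^bsub>B\<^esub> X h2) =
      sweedler B (comult H h) (\<lambda>h1 h2. F\<^sub>R h1 \<otimes>\<^bsub>B\<^esub> Y h2)"
    and h: "h \<in> carrier H"
  shows "X h = Y h"
proof -
  obtain S where "convolution_inverses K H H (\<lambda>h. h) S" using H.antipode by blast
  then have S: "linear_map K H H S"
    and inv: "\<And>h. h \<in> carrier H \<Longrightarrow>
      sweedler H (comult H h) (\<lambda>x y. x \<otimes>\<^bsub>H\<^esub> S y) = counit H h \<odot>\<^bsub>H\<^esub> \<one>\<^bsub>H\<^esub>"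
      "\<And>h. h \<in> carrier H \<Longrightarrow>
      sweedler H (comult H h) (\<lambda>x y. S x \<otimes>\<^bsub>H\<^esub> y) = counit H h \<odot>\<^bsub>H\<^esub> \<one>\<^bsub>H\<^esub>"
    by (auto simp: convolution_inverses_def)
  note Scl [simp] = linear_map_closed[OF S]
  define W where "W Z h = sweedler B (comult H h) (\<lambda>h1 h2. act (S h1) (Z h2))" for Z h
  have W: "linear_map K H B (W Z)" if "linear_map K H B Z" for Z
    unfolding W_def using linear_map_closed[OF that]
    by (intro linear_intros linear_map_comp[OF S] linear_map_comp[OF that]) (auto simp: closed)
  have recover: "sweedler B (comult H h) (\<lambda>h1 h2. act h1 (W Z h2)) = Z h"
    if "linear_map K H B Z" "h \<in> carrier H" for Z h
    unfolding W_def
    by (rule H.convolution_cancel[OF alg.module left_module_axioms linear_map_id S inv(1) that])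
  have untwist: "sweedler B (comult H h) (\<lambda>h1 h2. A_act (F (incl_H K H B h1)) (W Z h2)) =
      sweedler B (comult H h) (\<lambda>h1 h2. F\<^sub>R h1 \<otimes>\<^bsub>B\<^esub> Z h2)"
    if Z: "linear_map K H B Z" and h: "h \<in> carrier H" for Z h
  proof -
    note WZ = W[OF Z] and Wcl [simp] = linear_map_closed[OF W[OF Z]]
    have "sweedler B (comult H h) (\<lambda>h1 h2. A_act (F (incl_H K H B h1)) (W Z h2)) =
        sweedler B (comult H h) (\<lambda>h1 h2. sweedler B (comult H h1)
          (\<lambda>x y. F\<^sub>R x \<otimes>\<^bsub>B\<^esub> act y (W Z h2)))"
      by (intro H.CC.sweedler_cong) (auto simp: A_act_F_incl_H h)
    also have "\<dots> = sweedler B (comult H h) (\<lambda>h1 h2. sweedler B (comult H h2)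
          (\<lambda>x y. F\<^sub>R h1 \<otimes>\<^bsub>B\<^esub> act x (W Z y)))"
      by (intro H.coassoc_trilinear parts_intros linear_map_comp[OF WZ]) (auto simp: closed h)
    also have "\<dots> = sweedler B (comult H h) (\<lambda>h1 h2. F\<^sub>R h1 \<otimes>\<^bsub>B\<^esub>
          sweedler B (comult H h2) (\<lambda>x y. act x (W Z y)))"
      by (intro H.CC.sweedler_cong H.CC.linear_sweedler[OF alg.module alg.module, symmetric]
          linear_intros) (auto simp: closed h)
    also have "\<dots> = sweedler B (comult H h) (\<lambda>h1 h2. F\<^sub>R h1 \<otimes>\<^bsub>B\<^esub> Z h2)"
      by (intro H.CC.sweedler_cong) (auto simp: recover[OF Z] h)
    finally show ?thesis .
  qed
  have W_eq: "W X h = W Y h" if h: "h \<in> carrier H" for h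
  proof -
    have "W Z h = sweedler B (comult H h) (\<lambda>h1 h2. A_act (F (incl_H K H B (S h1)))
        (sweedler B (comult H h2) (\<lambda>h1 h2. F\<^sub>R h1 \<otimes>\<^bsub>B\<^esub> Z h2)))" if Z: "linear_map K H B Z" for Z
      using H.convolution_cancel[OF alg.module F_incl_H_module S linear_map_id inv(2) W[OF Z] h]
      by (simp add: untwist[OF Z] h cong: H.CC.sweedler_cong)
    from this[OF X] this[OF Y] show ?thesis
      by (simp add: eq h cong: H.CC.sweedler_cong)
  qed
  have "X h = sweedler B (comult H h) (\<lambda>h1 h2. act h1 (W X h2))"
    by (rule recover[OF X h, symmetric])
  also have "\<dots> = sweedler B (comult H h) (\<lambda>h1 h2. act h1 (W Y h2))"
    by (intro H.CC.sweedler_cong) (auto simp: W_eq h)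
  also have "\<dots> = Y h" by (rule recover[OF Y h])
  finally show ?thesis .
qed

lemma module_map_iff:
  "left_module_map K H B act B act F\<^sub>L \<longleftrightarrow>
    (\<forall>h \<in> carrier H. \<forall>b \<in> carrier B.
      sweedler B (comult H h) (\<lambda>h1 h2. F\<^sub>L (act h1 b) \<otimes>\<^bsub>B\<^esub> F\<^sub>R h2) =
      sweedler B (comult H h) (\<lambda>h1 h2. F\<^sub>R h1 \<otimes>\<^bsub>B\<^esub> F\<^sub>L (act h2 b)))"
  (is "_ \<longleftrightarrow> ?commute")
proof
  assume "left_module_map K H B act B act F\<^sub>L"
  then have "F\<^sub>L (act h b) = act h (F\<^sub>L b)" if "h \<in> carrier H" "b \<in> carrier B" for h b
    using that by (simp add: left_module_map_def)
  then show ?commute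
    by (auto simp flip: twisted_linearity intro!: H.CC.sweedler_cong)
next
  assume commute: ?commute
  have "F\<^sub>L (act h b) = act h (F\<^sub>L b)" if "h \<in> carrier H" "b \<in> carrier B" for h b
    using that
    by (intro F\<^sub>R_left_cancel[where X = "\<lambda>h. F\<^sub>L (act h b)" and Y = "\<lambda>h. act h (F\<^sub>L b)"]
        parts_intros)
      (auto simp: commute[rule_format, symmetric] twisted_linearity)
  then show "left_module_map K H B act B act F\<^sub>L"
    by (simp add: left_module_map_def F\<^sub>L_linear)
qed

lemma module_map_if_commutative:
  assumes "cring B" "cocommutative K H"
  shows "left_module_map K H B act B act F\<^sub>L"
  unfolding module_map_iff
proof (intro ballI)
  interpret cring B by fact
  fix h b assume h: "h \<in> carrier H" and b: "b \<in> carrier B"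
  let ?f = "\<lambda>h1 h2. F\<^sub>L (act h1 b) \<otimes>\<^bsub>B\<^esub> F\<^sub>R h2"
  have bil: "bilinear_map K H H B ?f"
    using b by (intro parts_intros) auto
  have "sweedler B (comult H h) ?f =
      sweedler B (sweedler (tensor K H H) (comult H h) (\<lambda>x y. pure_tensor K H H y x)) ?f"
    using assms(2) h by (simp add: cocommutative_def)
  also have "\<dots> = sweedler B (comult H h) (\<lambda>x y. sweedler B (pure_tensor K H H y x) ?f)"
    by (intro H.CC.linear_sweedler[OF H.CC.module_tensor alg.module
          H.CC.sweedler_linear[OF alg.module bil]] H.CC.pure_closed H.comult_closed h)
  also have "\<dots> = sweedler B (comult H h) (\<lambda>h1 h2. F\<^sub>R h1 \<otimes>\<^bsub>B\<^esub> F\<^sub>L (act h2 b))"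
    by (intro H.CC.sweedler_cong)
      (auto simp: h b H.CC.sweedler_pure[OF alg.module bil] m_comm)
  finally show "sweedler B (comult H h) ?f = \<dots>" .
qed

end

theorem corollary3:
  fixes K :: "('k, 'l) ring_scheme"
    and H :: "('k, 'h, 'm) hopf_scheme"
    and B :: "('k, 'b, 'n) hopf_scheme"
    and act :: "'h \<Rightarrow> 'b \<Rightarrow> 'b"
    and coact :: "'b \<Rightarrow> ('h \<times> 'b) list set"
    and F :: "('b \<times> 'h) list set \<Rightarrow> ('b \<times> 'h) list set"
  assumes "biproduct_datum K H B act coact"
    and "F \<in> End_Hopf K (biproduct K H B act coact) (proj_H H B)"
  defines "F\<^sub>L \<equiv> left_part K H B F"
    and "F\<^sub>R \<equiv> right_part K H B F"
  shows "(left_module_map K H B act B act F\<^sub>L \<longleftrightarrow>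
      (\<forall>h \<in> carrier H. \<forall>b \<in> carrier B.
        sweedler B (comult H h) (\<lambda>h1 h2. F\<^sub>L (act h1 b) \<otimes>\<^bsub>B\<^esub> F\<^sub>R h2) =
        sweedler B (comult H h) (\<lambda>h1 h2. F\<^sub>R h1 \<otimes>\<^bsub>B\<^esub> F\<^sub>L (act h2 b)))) \<and>
    (cring B \<and> cocommutative K H \<longrightarrow> left_module_map K H B act B act F\<^sub>L)"
proof -
  interpret biproduct_endomorphism K H B act coact F
    by (intro biproduct_endomorphism.intro biproduct_endomorphism_axioms.intro assms(1,2))
  show ?thesis
    unfolding F\<^sub>L_def F\<^sub>R_def using module_map_iff module_map_if_commutative by blast
qed

end
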